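(* Let $f_+$ and $f_-$ be probability mass functions on a finite set with $\min_i f_+(i)\ge\epsilon$ and $\min_i f_-(i)\ge\epsilon$ for a constant $\epsilon>0$. There exists a Monte Carlo algorithm for the clustering problem with perfect oracle and side information with query complexity $O\big(\frac{k^2\log n}{\Delta(f_+,f_-)}\big)$ when $f_+,f_-$ are known, and a Las Vegas algorithm with expected query complexity $O\big(n\log n+\frac{k^2\log n}{\Delta(f_+,f_-)}\big)$ even when $k$, $f_+$ and $f_-$ are unknown.
   Context: Clustering problem: the vertex set is $V=[n]$, partitioned into $k$ unknown nonempty clusters. Perfect oracle: a query is a pair $\{u,v\}$, answered $+1$ if $u,v$ are in the same cluster and $-1$ otherwise; queries may be adaptive. Side information: the algorithm is given a symmetric matrix $W=(w_{u,v})$ whose off-diagonal entries are independent random variables taking values in a finite set $\{a_1,\dots,a_q\}\subset[0,1]$, with $w_{u,v}\sim f_+$ if $u,v$ are in the same cluster and $w_{u,v}\sim f_-$ otherwise. $D(P\|Q)=\sum_x P(x)\ln\frac{P(x)}{Q(x)}$ is the Kullback–Leibler divergence and $\Delta(f_+,f_-)=D(f_+\|f_-)+D(f_-\|f_+)$. A Monte Carlo algorithm recovers the clusters correctly with high probability; a Las Vegas algorithm always recovers the clusters correctly. *)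

theory Defs
  imports "HOL-Probability.Probability"
begin

text \<open>
  A clustering of the vertex set \<open>{1..n}\<close> is a partition \<open>P\<close> in the sense of \<^const>\<open>partition_on\<close>
  (so clusters are nonempty); the number of clusters is \<open>card P\<close>.
\<close>

definition same_cluster :: "nat set set \<Rightarrow> nat \<Rightarrow> nat \<Rightarrow> bool" where
  "same_cluster P u v \<longleftrightarrow> (\<exists>C\<in>P. u \<in> C \<and> v \<in> C)"

text \<open>
  Adaptive querying is modelled by decision trees: \<open>Query u v yes no\<close> asks the oracle about
  the pair \<open>u, v\<close> and continues with \<open>yes\<close> on the answer \<open>+1\<close> and with \<open>no\<close> on the answer \<open>-1\<close>.
\<close>

datatype qtree = Output "nat set set" | Query nat nat qtree qtree

fun valid_qtree :: "nat \<Rightarrow> qtree \<Rightarrow> bool" where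
  "valid_qtree n (Output R) \<longleftrightarrow> True"
| "valid_qtree n (Query u v yes no) \<longleftrightarrow>
     u \<in> {1..n} \<and> v \<in> {1..n} \<and> u \<noteq> v \<and> valid_qtree n yes \<and> valid_qtree n no"

fun run :: "nat set set \<Rightarrow> qtree \<Rightarrow> nat set set" where
  "run P (Output R) = R"
| "run P (Query u v yes no) = run P (if same_cluster P u v then yes else no)"

fun num_queries :: "nat set set \<Rightarrow> qtree \<Rightarrow> nat" where
  "num_queries P (Output R) = 0"
| "num_queries P (Query u v yes no) = Suc (num_queries P (if same_cluster P u v then yes else no))"

text \<open>
  The law of the side information matrix. The entries above the diagonal are drawn independently
  and the matrix is symmetric; the diagonal, which carries no information, is \<open>0\<close>.
\<close>

definition side_info ::
    "nat \<Rightarrow> nat set set \<Rightarrow> real pmf \<Rightarrow> real pmf \<Rightarrow> (nat \<Rightarrow> nat \<Rightarrow> real) pmf" where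
  "side_info n P fp fm =
     map_pmf (\<lambda>w u v. w (min u v, max u v))
       (Pi_pmf {(u, v). 1 \<le> u \<and> u < v \<and> v \<le> n} 0
          (\<lambda>(u, v). if same_cluster P u v then fp else fm))"

text \<open>Only meant for distributions with finite support such that \<open>f\<close> is absolutely continuous
  with respect to \<open>g\<close>.\<close>

definition kl_div :: "'a pmf \<Rightarrow> 'a pmf \<Rightarrow> real" where
  "kl_div f g = (\<Sum>x\<in>set_pmf f. pmf f x * ln (pmf f x / pmf g x))"

definition sym_kl :: "'a pmf \<Rightarrow> 'a pmf \<Rightarrow> real" where
  "sym_kl f g = kl_div f g + kl_div g f"

definition admissible :: "real \<Rightarrow> real set \<Rightarrow> real pmf \<Rightarrow> real pmf \<Rightarrow> bool" where
  "admissible \<epsilon> A fp fm \<longleftrightarrow>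
     finite A \<and> A \<subseteq> {0..1} \<and> set_pmf fp \<subseteq> A \<and> set_pmf fm \<subseteq> A \<and>
     (\<forall>a\<in>A. pmf fp a \<ge> \<epsilon> \<and> pmf fm a \<ge> \<epsilon>)"

text \<open>
  An algorithm maps what it knows (always \<open>n\<close> and the side information matrix) to a random
  decision tree, the randomness of the tree being the internal randomness of the algorithm.
  The Monte Carlo algorithm additionally knows \<open>fp\<close> and \<open>fm\<close>.
\<close>

type_synonym mc_alg = "nat \<Rightarrow> real pmf \<Rightarrow> real pmf \<Rightarrow> (nat \<Rightarrow> nat \<Rightarrow> real) \<Rightarrow> qtree pmf"
type_synonym lv_alg = "nat \<Rightarrow> (nat \<Rightarrow> nat \<Rightarrow> real) \<Rightarrow> qtree pmf"

end

theory Submission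
  imports Defs "HOL-Library.Discrete_Functions"
begin

text \<open>
  Both algorithms insert the vertices \<open>1, 2, \<dots>, n\<close> one after the other, so that, as long as no mistake
  occurs, the clusters known when \<open>v\<close> arrives are the sets \<open>C \<inter> {1..<v}\<close>. These do not depend on the
  side information, hence Hoeffding's inequality and a union bound apply to the empirical
  distribution of \<open>w(v, u)\<close>, \<open>u \<in> C \<inter> {1..<v}\<close>, although the queries are adaptive.
  If \<open>D\<close> is the largest pointwise gap of \<open>f\<^sub>+\<close> and \<open>f\<^sub>-\<close>, then \<open>\<Delta> \<le> D\<^sup>2 / \<epsilon>\<^sup>2\<close>, so
  \<open>M = O(log n / \<Delta>)\<close> samples suffice to tell \<open>f\<^sub>+\<close> from \<open>f\<^sub>-\<close> up to an error polynomially small in \<open>n\<close>.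

  Monte Carlo: a vertex joins a known cluster with at least \<open>M\<close> members without a query if the empirical
  frequency of the value realising the gap looks like \<open>f\<^sub>+\<close>; otherwise it is queried against one
  representative of each known cluster, and the algorithm gives up when it turns out to belong to
  a cluster with at least \<open>M\<close> members. So at most \<open>k M + 1\<close> vertices are queried, at most \<open>k\<close> times each.

  Las Vegas: every assignment is confirmed by a query, and the side information only orders
  the candidates. The internal empirical distribution of a cluster serves as an estimate of \<open>f\<^sub>+\<close>. Since
  \<open>M\<close> is unknown, for each scale \<open>2\<^sup>j \<le> n\<close> the best candidate among the clusters with at least \<open>2\<^sup>j\<close>
  members is tried before all clusters. With high probability this finds the cluster of
  \<open>v\<close> within \<open>O(log n)\<close> queries once that cluster has \<open>2 M\<close> known members, so only \<open>2 k M\<close> vertices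
  incur \<open>k\<close> further queries.
\<close>

subsection \<open>Concentration of the side information\<close>

text \<open>Hoeffding's inequality for the indicators of \<open>w j = a\<close>, which on
  \<open>J\<close> are independent Bernoulli variables of mean \<open>pmf f a\<close>; coordinates
  outside \<open>J\<close> may have any law.\<close>

lemma Pi_pmf_frequency_concentration:
  fixes p :: "'i \<Rightarrow> 'a pmf" and \<eta> :: real
  assumes I: "finite I" and J: "J \<subseteq> I" "J \<noteq> {}" and p: "\<And>j. j \<in> J \<Longrightarrow> p j = f" and \<eta>: "\<eta> \<ge> 0"
  shows "measure_pmf.prob (Pi_pmf I d p)
           {w. \<bar>real (card {j \<in> J. w j = a}) / real (card J) - pmf f a\<bar> \<ge> \<eta>}
         \<le> 2 * exp (- 2 * real (card J) * \<eta>\<^sup>2)"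
proof -
  have finJ: "finite J" using I J finite_subset by blast
  obtain j0 where j0: "j0 \<in> J" using J by blast
  let ?X = "\<lambda>j w. if w j = a then 1 else (0::real)"
  have component: "map_pmf (\<lambda>w. w j) (Pi_pmf I d p) = f" if "j \<in> J" for j
    using that I J p by (subst Pi_pmf_component) auto
  have distr: "distr (measure_pmf (Pi_pmf I d p)) borel (?X j) =
      distr (measure_pmf f) borel (\<lambda>x. if x = a then 1 else 0)" if "j \<in> J" for j
  proof -
    have "distr (measure_pmf (Pi_pmf I d p)) borel (?X j) =
        distr (measure_pmf (map_pmf (\<lambda>w. w j) (Pi_pmf I d p))) borel (\<lambda>x. if x = a then 1 else 0)"
      unfolding map_pmf_rep_eq by (subst distr_distr) (auto simp: o_def)
    then show ?thesis using component[OF that] by simp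
  qed
  have expect: "measure_pmf.expectation (Pi_pmf I d p) (?X j0) = pmf f a"
  proof -
    have "measure_pmf.expectation (Pi_pmf I d p) (?X j0) =
        measure_pmf.expectation (map_pmf (\<lambda>w. w j0) (Pi_pmf I d p)) (indicat_real {a})"
      by (simp only: integral_map_pmf indicator_def singleton_iff of_bool_def)
    then show ?thesis using component[OF j0] by (simp add: measure_pmf_single)
  qed
  interpret Hoeffding_ineq_iid "measure_pmf (Pi_pmf I d p)" J ?X "?X j0" 0 1 "pmf f a"
  proof unfold_locales
    have "prob_space.indep_vars (measure_pmf (Pi_pmf I d p)) (\<lambda>_. borel) ?X I"
      by (intro prob_space.indep_vars_compose2[OF _ indep_vars_Pi_pmf])
        (auto simp: I measure_pmf.prob_space_axioms)
    then show "prob_space.indep_vars (measure_pmf (Pi_pmf I d p)) (\<lambda>_. borel) ?X J"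
      by (rule prob_space.indep_vars_subset[OF measure_pmf.prob_space_axioms]) (rule J(1))
  qed (use finJ distr j0 expect in auto)
  have "(\<Sum>j\<in>J. ?X j w) = real (card {j \<in> J. w j = a})" for w
    using finJ by (simp add: sum.If_cases Int_def conj_commute)
  then show ?thesis
    using Hoeffding_ineq_abs_ge'[OF \<eta> _ J(2)] by simp
qed

lemma prob_UNION_le_card:
  assumes "finite Q" "\<And>q. q \<in> Q \<Longrightarrow> measure_pmf.prob p (E q) \<le> x"
  shows "measure_pmf.prob p (\<Union>q\<in>Q. E q) \<le> real (card Q) * x"
proof -
  have "measure_pmf.prob p (\<Union>q\<in>Q. E q) \<le> (\<Sum>q\<in>Q. measure_pmf.prob p (E q))"
    using assms(1) by (intro measure_UNION_le) auto
  also have "\<dots> \<le> real (card Q) * x"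
    using assms(2) by (rule sum_bounded_above)
  finally show ?thesis .
qed

lemma exp_neg_mult_ln_le:
  assumes "n \<ge> 1" "x \<ge> real m * ln (real n)"
  shows "exp (- x) \<le> 1 / real n ^ m"
proof -
  have "exp (- x) \<le> exp (- ln (real n ^ m))" using assms by (simp add: ln_realpow)
  also have "\<dots> = 1 / real n ^ m" using assms by (simp add: exp_minus divide_inverse)
  finally show ?thesis .
qed

text \<open>The empirical distribution of row \<open>v\<close> over \<open>K\<close>. For empty
  \<open>K\<close> it is constantly 0, and this is what a singleton cluster gets as its internal
  profile.\<close>

definition freq :: "(nat \<Rightarrow> nat \<Rightarrow> real) \<Rightarrow> nat \<Rightarrow> nat set \<Rightarrow> real \<Rightarrow> real" where
  "freq W v K a = real (card {u \<in> K. W v u = a}) / real (card K)"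

lemma freq_nonneg: "freq W v K a \<ge> 0"
  by (simp add: freq_def)

lemma freq_le_1: "freq W v K a \<le> 1"
proof (cases "finite K")
  case True
  then have "card {u \<in> K. W v u = a} \<le> card K" by (intro card_mono) auto
  then show ?thesis by (auto simp: freq_def divide_le_eq_1)
qed (simp add: freq_def)

lemma same_cluster_sym: "same_cluster P u v \<longleftrightarrow> same_cluster P v u"
  by (auto simp: same_cluster_def)

lemma finite_pairs: "finite {(u, v). (1::nat) \<le> u \<and> u < v \<and> v \<le> n}"
  by (rule finite_subset[of _ "{1..n} \<times> {1..n}"]) auto

text \<open>The pairs of \<open>v\<close> with the members of \<open>K\<close>, written with the
  smaller vertex first, are distinct coordinates of the product, and the condition on
  \<open>b\<close> gives them all the same law.\<close>

lemma side_info_frequency_concentration: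
  assumes v: "v \<in> {1..n}" and K: "K \<subseteq> {1..n}" "v \<notin> K" "K \<noteq> {}"
    and b: "\<And>u. u \<in> K \<Longrightarrow> same_cluster P v u \<longleftrightarrow> b" and \<eta>: "\<eta> \<ge> 0"
  shows "measure_pmf.prob (side_info n P fp fm)
           {W. \<bar>freq W v K a - pmf (if b then fp else fm) a\<bar> \<ge> \<eta>}
         \<le> 2 * exp (- 2 * real (card K) * \<eta>\<^sup>2)"
proof -
  let ?e = "\<lambda>u. (min v u, max v u)"
  let ?I = "{(u, v). 1 \<le> u \<and> u < v \<and> v \<le> n}"
  have inj: "inj_on ?e K" by (auto simp: inj_on_def min_def max_def split: if_splits)
  have sub: "?e ` K \<subseteq> ?I"
  proof
    fix x assume "x \<in> ?e ` K"
    then obtain u where "u \<in> K" "x = ?e u" by blast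
    moreover have "u \<noteq> v" "1 \<le> u" "u \<le> n" using \<open>u \<in> K\<close> K by auto
    ultimately show "x \<in> ?I" using v by (auto simp: min_def max_def)
  qed
  have "(if same_cluster P (min v u) (max v u) then fp else fm) = (if b then fp else fm)"
    if "u \<in> K" for u
    using b[OF that] same_cluster_sym[of P u v] by (auto simp: min_def max_def)
  then have conc: "measure_pmf.prob (Pi_pmf ?I 0 (\<lambda>(u, v). if same_cluster P u v then fp else fm))
           {w. \<bar>real (card {j \<in> ?e ` K. w j = a}) / real (card (?e ` K)) -
              pmf (if b then fp else fm) a\<bar> \<ge> \<eta>}
         \<le> 2 * exp (- 2 * real (card (?e ` K)) * \<eta>\<^sup>2)"
    using K by (intro Pi_pmf_frequency_concentration finite_pairs sub \<eta>) auto
  have "card {j \<in> ?e ` K. w j = a} = card {u \<in> K. w (?e u) = a}" for w :: "nat \<times> nat \<Rightarrow> real"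
  proof -
    have "{j \<in> ?e ` K. w j = a} = ?e ` {u \<in> K. w (?e u) = a}" by auto
    then show ?thesis
      using card_image[OF inj_on_subset[OF inj, of "{u \<in> K. w (?e u) = a}"]] by auto
  qed
  then show ?thesis
    using conc card_image[OF inj] by (simp add: side_info_def freq_def)
qed

lemma side_info_support:
  assumes "W \<in> set_pmf (side_info n P fp fm)" "u \<in> {1..n}" "v \<in> {1..n}" "u \<noteq> v"
  shows "W u v \<in> set_pmf fp \<union> set_pmf fm"
proof -
  obtain w where W: "W = (\<lambda>u v. w (min u v, max u v))"
    and w: "w \<in> PiE_dflt {(u, v). 1 \<le> u \<and> u < v \<and> v \<le> n} 0
      (set_pmf \<circ> (\<lambda>(u, v). if same_cluster P u v then fp else fm))"
    using assms(1) unfolding side_info_def set_map_pmf set_Pi_pmf[OF finite_pairs] by blast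
  have "(min u v, max u v) \<in> {(u, v). 1 \<le> u \<and> u < v \<and> v \<le> n}"
    using assms by (auto simp: min_def max_def)
  with w have "w (min u v, max u v) \<in>
      (set_pmf \<circ> (\<lambda>(u, v). if same_cluster P u v then fp else fm)) (min u v, max u v)"
    unfolding PiE_dflt_def by blast
  then show ?thesis by (auto simp: W split: if_splits)
qed

subsection \<open>Divergence and the largest gap of the distributions\<close>

lemma admissible_support:
  assumes "admissible \<epsilon> A fp fm" "\<epsilon> > 0"
  shows "set_pmf fp = A" "set_pmf fm = A" "finite A" "A \<noteq> {}"
proof -
  show "set_pmf fp = A" "set_pmf fm = A" "finite A"
    using assms by (fastforce simp: admissible_def set_pmf_iff)+
  then show "A \<noteq> {}" using set_pmf_not_empty by metis
qed

text \<open>Bounds the alphabet size by \<open>1 / \<epsilon>\<close>, so that no constant depends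
  on \<open>A\<close>.\<close>

lemma admissible_card:
  assumes "admissible \<epsilon> A fp fm" "\<epsilon> > 0"
  shows "real (card A) * \<epsilon> \<le> 1"
proof -
  note s = admissible_support[OF assms]
  have "real (card A) * \<epsilon> = (\<Sum>a\<in>A. \<epsilon>)" by simp
  also have "\<dots> \<le> (\<Sum>a\<in>A. pmf fp a)"
    using assms by (intro sum_mono) (auto simp: admissible_def)
  also have "\<dots> = 1" using s by (intro sum_pmf_eq_1) auto
  finally show ?thesis .
qed

text \<open>By symmetry the larger of \<open>p\<close> and \<open>q\<close> may be the numerator;
  then \<open>ln x \<le> x - 1\<close> for the ratio suffices.\<close>

lemma diff_times_ln_ratio_le:
  fixes p q \<epsilon> :: real
  assumes "\<epsilon> > 0" "p \<ge> \<epsilon>" "q \<ge> \<epsilon>"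
  shows "(p - q) * ln (p / q) \<le> (p - q)\<^sup>2 / \<epsilon>"
proof -
  have *: "(x - y) * ln (x / y) \<le> (x - y)\<^sup>2 / \<epsilon>" if "x \<ge> y" "y \<ge> \<epsilon>" for x y :: real
  proof -
    have "y > 0" "x > 0" using that assms by auto
    then have "ln (x / y) \<le> x / y - 1" by (intro ln_le_minus_one) auto
    also have "\<dots> = (x - y) / y" using \<open>y > 0\<close> by (simp add: field_simps)
    also have "\<dots> \<le> (x - y) / \<epsilon>"
      using that assms by (intro divide_left_mono) auto
    finally have "(x - y) * ln (x / y) \<le> (x - y) * ((x - y) / \<epsilon>)"
      using that by (intro mult_left_mono) auto
    then show ?thesis by (simp add: power2_eq_square)
  qed
  show ?thesis
  proof (cases "p \<ge> q")
    case False
    have "(p - q) * ln (p / q) = (q - p) * ln (q / p)"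
      using assms by (simp add: ln_div algebra_simps)
    then show ?thesis using *[of p q] False assms by (simp add: power2_commute)
  qed (use * assms in auto)
qed

text \<open>The two divergences add up to the sum of \<open>(p - q) * ln (p / q)\<close> over
  \<open>A\<close>. Each term is at most \<open>D\<^sup>2 / \<epsilon>\<close>, and
  \<open>card A \<le> 1 / \<epsilon>\<close> supplies the second factor.\<close>

lemma sym_kl_le:
  assumes adm: "admissible \<epsilon> A fp fm" and \<epsilon>: "\<epsilon> > 0"
    and D: "\<And>a. \<bar>pmf fp a - pmf fm a\<bar> \<le> D"
  shows "sym_kl fp fm \<le> D\<^sup>2 / \<epsilon>\<^sup>2"
proof -
  note s = admissible_support[OF adm \<epsilon>]
  have pos: "pmf fp a \<ge> \<epsilon>" "pmf fm a \<ge> \<epsilon>" if "a \<in> A" for a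
    using adm that by (auto simp: admissible_def)
  have "sym_kl fp fm = (\<Sum>a\<in>A. (pmf fp a - pmf fm a) * ln (pmf fp a / pmf fm a))"
    unfolding sym_kl_def kl_div_def s sum.distrib[symmetric]
  proof (rule sum.cong)
    fix a assume "a \<in> A"
    then have "pmf fp a > 0" "pmf fm a > 0" using pos[of a] \<epsilon> by auto
    then show "pmf fp a * ln (pmf fp a / pmf fm a) + pmf fm a * ln (pmf fm a / pmf fp a) =
        (pmf fp a - pmf fm a) * ln (pmf fp a / pmf fm a)"
      by (simp add: ln_div algebra_simps)
  qed simp
  also have "\<dots> \<le> (\<Sum>a\<in>A. D\<^sup>2 / \<epsilon>)"
  proof (rule sum_mono)
    fix a assume "a \<in> A"
    then have "(pmf fp a - pmf fm a) * ln (pmf fp a / pmf fm a) \<le> (pmf fp a - pmf fm a)\<^sup>2 / \<epsilon>"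
      by (intro diff_times_ln_ratio_le pos \<epsilon>)
    also have "\<dots> \<le> D\<^sup>2 / \<epsilon>"
      using D[of a] \<epsilon> by (intro divide_right_mono) (auto simp: abs_le_square_iff[symmetric])
    finally show "(pmf fp a - pmf fm a) * ln (pmf fp a / pmf fm a) \<le> D\<^sup>2 / \<epsilon>" .
  qed
  also have "\<dots> = (real (card A) * \<epsilon>) * (D\<^sup>2 / \<epsilon>\<^sup>2)"
    using \<epsilon> by (simp add: field_simps power2_eq_square)
  also have "\<dots> \<le> 1 * (D\<^sup>2 / \<epsilon>\<^sup>2)"
    using admissible_card[OF adm \<epsilon>] by (intro mult_right_mono) auto
  finally show ?thesis by simp
qed

definition gap_point :: "'a pmf \<Rightarrow> 'a pmf \<Rightarrow> 'a" where
  "gap_point f g = (SOME a. \<forall>b. \<bar>pmf f b - pmf g b\<bar> \<le> \<bar>pmf f a - pmf g a\<bar>)"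

definition gap :: "'a pmf \<Rightarrow> 'a pmf \<Rightarrow> real" where
  "gap f g = \<bar>pmf f (gap_point f g) - pmf g (gap_point f g)\<bar>"

text \<open>A maximum exists over the whole type: off both supports the difference is 0, so only
  finitely many values occur.\<close>

lemma gap_ge:
  assumes "finite (set_pmf f)" "finite (set_pmf g)"
  shows "\<bar>pmf f b - pmf g b\<bar> \<le> gap f g"
proof -
  let ?h = "\<lambda>a. \<bar>pmf f a - pmf g a\<bar>"
  have "finite (range ?h)"
  proof (rule finite_subset)
    show "range ?h \<subseteq> insert 0 (?h ` (set_pmf f \<union> set_pmf g))"
      by (auto simp: image_iff set_pmf_iff)
  qed (use assms in auto)
  then have "Max (range ?h) \<in> range ?h" "\<And>b. ?h b \<le> Max (range ?h)"
    by (auto intro!: Max_in)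
  then have "\<exists>a. \<forall>b. ?h b \<le> ?h a" by (metis (no_types, lifting) imageE)
  from someI_ex[OF this] show ?thesis by (simp add: gap_def gap_point_def)
qed

lemma gap_nonneg: "gap f g \<ge> 0" and gap_le_1: "gap f g \<le> 1"
  using pmf_le_1[of f "gap_point f g"] pmf_le_1[of g "gap_point f g"]
    pmf_nonneg[of f "gap_point f g"] pmf_nonneg[of g "gap_point f g"]
  by (auto simp: gap_def abs_le_iff simp del: pmf_nonneg)

lemma sym_kl_le_gap:
  assumes "admissible \<epsilon> A fp fm" "\<epsilon> > 0"
  shows "sym_kl fp fm \<le> (gap fp fm)\<^sup>2 / \<epsilon>\<^sup>2"
  using sym_kl_le[OF assms gap_ge] admissible_support[OF assms] by auto

subsection \<open>Query trees that reveal the vertices one by one\<close>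

lemma partition_on_unique:
  assumes "partition_on V P" "C \<in> P" "D \<in> P" "x \<in> C" "x \<in> D"
  shows "C = D"
  using disjointD[OF partition_onD2[OF assms(1)] assms(2,3)] assms(4,5) by auto

lemma same_cluster_iff:
  assumes "partition_on V P" "C \<in> P" "v \<in> C"
  shows "same_cluster P v u \<longleftrightarrow> u \<in> C"
proof
  assume "same_cluster P v u"
  then obtain D where "D \<in> P" "v \<in> D" "u \<in> D" by (auto simp: same_cluster_def)
  then show "u \<in> C" using partition_on_unique[OF assms(1,2) _ assms(3)] by auto
qed (use assms in \<open>auto simp: same_cluster_def\<close>)

text \<open>The smallest member represents a cluster, since it stays the same when a later vertex
  joins.\<close>

fun ask :: "nat \<Rightarrow> nat set list \<Rightarrow> (nat set \<Rightarrow> qtree) \<Rightarrow> qtree \<Rightarrow> qtree" where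
  "ask v [] f t = t"
| "ask v (c # cs) f t = Query v (Min c) (f c) (ask v cs f t)"

fun ask_cost :: "nat set set \<Rightarrow> nat \<Rightarrow> nat set list \<Rightarrow> nat" where
  "ask_cost P v [] = 0"
| "ask_cost P v (c # cs) = (if same_cluster P v (Min c) then 1 else Suc (ask_cost P v cs))"

lemma ask_cost_le_length: "ask_cost P v cs \<le> length cs"
  by (induction cs) auto

text \<open>A hit among the guesses \<open>cs\<close> makes the exhaustive list \<open>ds\<close>
  behind them free of charge.\<close>

lemma ask_cost_append_le:
  assumes "c \<in> set cs" "same_cluster P v (Min c)"
  shows "ask_cost P v (cs @ ds) \<le> length cs"
  using assms by (induction cs) auto

text \<open>Uniqueness of the match takes the place of distinctness of \<open>cs\<close>, because
  the Las Vegas list contains its guesses a second time.\<close>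

lemma ask_found:
  assumes "c \<in> set cs" "same_cluster P v (Min c)"
    "\<And>d. d \<in> set cs \<Longrightarrow> same_cluster P v (Min d) \<Longrightarrow> d = c"
  shows "run P (ask v cs f t) = run P (f c) \<and>
    num_queries P (ask v cs f t) = ask_cost P v cs + num_queries P (f c)"
  using assms
proof (induction cs)
  case (Cons d cs)
  show ?case
  proof (cases "same_cluster P v (Min d)")
    case True
    then have "d = c" using Cons.prems(3)[of d] by simp
    then show ?thesis using True by simp
  next
    case False
    then have "c \<in> set cs" using Cons.prems(1,2) by auto
    from Cons.IH[OF this Cons.prems(2)] Cons.prems(3) show ?thesis using False by simp
  qed
qed simp

lemma ask_not_found:
  assumes "\<And>d. d \<in> set cs \<Longrightarrow> \<not> same_cluster P v (Min d)"
  shows "run P (ask v cs f t) = run P t"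
    "num_queries P (ask v cs f t) = ask_cost P v cs + num_queries P t"
  using assms by (induction cs) auto

lemma valid_ask:
  assumes "v \<in> {1..n}" "valid_qtree n t"
    "\<And>c. c \<in> set cs \<Longrightarrow> Min c \<in> {1..n} \<and> Min c \<noteq> v \<and> valid_qtree n (f c)"
  shows "valid_qtree n (ask v cs f t)"
  using assms by (induction cs) auto

section \<open>Inserting the vertices one after the other\<close>

definition add_to :: "nat \<Rightarrow> nat set \<Rightarrow> nat set set \<Rightarrow> nat set set" where
  "add_to v c S = insert (insert v c) (S - {c})"

text \<open>The common skeleton: \<open>skip\<close> assigns a vertex without a query,
  \<open>ord\<close> lists the candidates to ask, and \<open>halt\<close> gives up, with the dummy
  output \<open>{}\<close>, on a positive answer from a cluster that should have been recognised
  earlier.\<close>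

fun cluster_tree :: "(nat \<Rightarrow> nat set set \<Rightarrow> nat set option) \<Rightarrow> (nat set \<Rightarrow> bool) \<Rightarrow>
    (nat \<Rightarrow> nat set set \<Rightarrow> nat set list) \<Rightarrow> nat list \<Rightarrow> nat set set \<Rightarrow> qtree" where
  "cluster_tree skip halt ord [] S = Output S"
| "cluster_tree skip halt ord (v # vs) S = (case skip v S of
     Some c \<Rightarrow> cluster_tree skip halt ord vs (add_to v c S)
   | None \<Rightarrow> ask v (ord v S)
       (\<lambda>c. if halt c then Output {} else cluster_tree skip halt ord vs (add_to v c S))
       (cluster_tree skip halt ord vs (insert {v} S)))"

text \<open>Just enough for valid queries: representatives exist, are vertices and differ from
  \<open>v\<close>. This persists on runs with wrong assignments.\<close>

definition partial_clusters :: "nat \<Rightarrow> nat set set \<Rightarrow> bool" where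
  "partial_clusters v S \<longleftrightarrow> finite S \<and> {} \<notin> S \<and> (\<forall>c\<in>S. \<forall>x\<in>c. 1 \<le> x \<and> x < v)"

lemma partial_clusters_join:
  assumes "partial_clusters v S" "c \<in> S" "v \<ge> 1"
  shows "partial_clusters (Suc v) (add_to v c S)"
  using assms by (auto simp: partial_clusters_def add_to_def less_Suc_eq)

lemma partial_clusters_new:
  assumes "partial_clusters v S" "v \<ge> 1"
  shows "partial_clusters (Suc v) (insert {v} S)"
  using assms by (auto simp: partial_clusters_def less_Suc_eq)

lemma finite_partial_cluster:
  assumes "partial_clusters v S" "c \<in> S"
  shows "finite c" "c \<noteq> {}" "v \<notin> c"
proof -
  have "c \<subseteq> {1..<v}" using assms by (auto simp: partial_clusters_def)
  then show "finite c" by (rule finite_subset) simp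
qed (use assms in \<open>auto simp: partial_clusters_def\<close>)

lemma Min_partial_clusters:
  assumes "partial_clusters v S" "c \<in> S"
  shows "Min c \<in> c" "Min c \<in> {1..<v}"
proof -
  show "Min c \<in> c" using finite_partial_cluster[OF assms] by simp
  then show "Min c \<in> {1..<v}" using assms by (simp add: partial_clusters_def)
qed

lemma valid_cluster_tree:
  assumes skip: "\<And>v S c. partial_clusters v S \<Longrightarrow> skip v S = Some c \<Longrightarrow> c \<in> S"
    and ord: "\<And>v S. partial_clusters v S \<Longrightarrow> set (ord v S) \<subseteq> S"
    and "1 \<le> v" "v \<le> Suc n" "partial_clusters v S"
  shows "valid_qtree n (cluster_tree skip halt ord [v..<Suc n] S)"
  using assms(4,3,5)
proof (induction v arbitrary: S rule: inc_induct)
  case (step v)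
  have upt: "[v..<Suc n] = v # [Suc v..<Suc n]" using step by (simp add: upt_conv_Cons)
  have "valid_qtree n (ask v (ord v S)
      (\<lambda>c. if halt c then Output {} else cluster_tree skip halt ord [Suc v..<Suc n] (add_to v c S))
      (cluster_tree skip halt ord [Suc v..<Suc n] (insert {v} S)))"
  proof (rule valid_ask)
    show "valid_qtree n (cluster_tree skip halt ord [Suc v..<Suc n] (insert {v} S))"
      using step.prems partial_clusters_new by (intro step.IH) auto
    fix c assume "c \<in> set (ord v S)"
    then have c: "c \<in> S" using ord step.prems by blast
    then show "Min c \<in> {1..n} \<and> Min c \<noteq> v \<and> valid_qtree n (if halt c then Output {}
        else cluster_tree skip halt ord [Suc v..<Suc n] (add_to v c S))"
      using Min_partial_clusters[OF step.prems(2) c] step.hyps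
        step.IH[OF _ partial_clusters_join[OF step.prems(2) c step.prems(1)]]
      by (auto simp del: upt_Suc)
  qed (use step in auto)
  moreover have "valid_qtree n (cluster_tree skip halt ord [Suc v..<Suc n] (add_to v c S))"
    if "skip v S = Some c" for c
    using that step.prems skip by (intro step.IH partial_clusters_join) auto
  ultimately show ?case unfolding upt by (simp split: option.split del: upt_Suc)
qed simp

text \<open>The state of a run without mistakes when \<open>v\<close> arrives; clusters without a
  member below \<open>v\<close> have an empty trace and are dropped.\<close>

definition revealed :: "nat set set \<Rightarrow> nat \<Rightarrow> nat set set" where
  "revealed P v = (\<lambda>C. C \<inter> {1..<v}) ` P - {{}}"

text \<open>Only representatives are compared, so the property survives a vertex joining a wrong
  cluster. It still limits the number of known clusters to \<open>card P\<close>, whatever the side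
  information.\<close>

definition separated :: "nat set set \<Rightarrow> nat set set \<Rightarrow> bool" where
  "separated P S \<longleftrightarrow> (\<forall>c\<in>S. \<forall>d\<in>S. same_cluster P (Min c) (Min d) \<longrightarrow> c = d)"

text \<open>Since \<open>v\<close> exceeds all members of \<open>c\<close>, the representative of
  the enlarged cluster is still \<open>Min c\<close>.\<close>

lemma separated_join:
  assumes S: "partial_clusters v S" "separated P S" "c \<in> S"
  shows "separated P (add_to v c S)"
proof -
  have "Min (insert v c) = min v (Min c)"
    using finite_partial_cluster[OF S(1,3)] by simp
  then have "Min (insert v c) = Min c"
    using Min_partial_clusters(2)[OF S(1,3)] by simp
  then show ?thesis using S(2,3) by (auto simp: separated_def add_to_def)
qed

lemma separated_new:
  assumes "separated P S" "\<And>c. c \<in> S \<Longrightarrow> \<not> same_cluster P v (Min c)"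
  shows "separated P (insert {v} S)"
  using assms(1) assms(2)[unfolded same_cluster_sym[of P v]] assms(2) by (simp add: separated_def)

lemma revealed_1: "revealed P 1 = {}"
  by (auto simp: revealed_def)

text \<open>The potential \<open>\<Sum>c\<in>S. min (card c) M\<close> grows by one with every queried vertex.\<close>

lemma potential_join:
  assumes S: "partial_clusters v S" "c \<in> S"
  shows "(\<Sum>d\<in>add_to v c S. min (card d) M) + min (card c) M =
    (\<Sum>d\<in>S. min (card d) M) + min (Suc (card c)) M"
proof -
  have fin: "finite S" "finite c" and v: "v \<notin> c" "insert v c \<notin> S"
    using S finite_partial_cluster[OF S] by (auto simp: partial_clusters_def)
  have "(\<Sum>d\<in>add_to v c S. min (card d) M) = min (Suc (card c)) M + (\<Sum>d\<in>S - {c}. min (card d) M)"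
    unfolding add_to_def using fin v by (subst sum.insert) auto
  moreover have "(\<Sum>d\<in>S. min (card d) M) = min (card c) M + (\<Sum>d\<in>S - {c}. min (card d) M)"
    using fin(1) S(2) by (rule sum.remove)
  ultimately show ?thesis by simp
qed

lemma potential_new:
  assumes S: "partial_clusters v S" and "M \<ge> 1"
  shows "(\<Sum>d\<in>insert {v} S. min (card d) M) = Suc (\<Sum>d\<in>S. min (card d) M)"
proof -
  have "finite S" "{v} \<notin> S" using S by (auto simp: partial_clusters_def)
  then show ?thesis using assms(2) by simp
qed

subsection \<open>The two algorithms\<close>

text \<open>Absorbs additive constants into multiples of \<open>ln n\<close>. For
  \<open>n = 1\<close> the logarithm vanishes, so the query bounds treat that case
  separately.\<close>

lemma half_le_ln: "n \<ge> 2 \<Longrightarrow> 1 / 2 \<le> ln (real n)"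
proof -
  assume "n \<ge> 2"
  then have "1 - 1 / 2 \<le> 1 - inverse (real n)" by (simp add: field_simps)
  also have "\<dots> \<le> ln (real n)"
    using \<open>n \<ge> 2\<close> ln_le_minus_one[of "inverse (real n)"] by (simp add: ln_inverse)
  finally show ?thesis by simp
qed

text \<open>The number of scales, hence of guesses per vertex, is logarithmic:
  \<open>ln 2 \<ge> 1 / 2\<close> costs a factor 2, and the extra scale is absorbed by another
  \<open>2 * ln n\<close>.\<close>

lemma Suc_floor_log_le: "n \<ge> 2 \<Longrightarrow> real (Suc (floor_log n)) \<le> 4 * ln (real n)"
proof -
  assume n: "n \<ge> 2"
  have "(2::real) ^ floor_log n \<le> real n"
    using floor_log_exp2_le[of n] n
    by (metis not_numeral_le_zero of_nat_le_iff of_nat_numeral of_nat_power zero_less_iff_neq_zero)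
  then have "ln ((2::real) ^ floor_log n) \<le> ln (real n)" using n by (subst ln_le_cancel_iff) auto
  then have "real (floor_log n) * ln 2 \<le> ln (real n)" by (simp add: ln_realpow)
  moreover have "real (floor_log n) * (1 / 2) \<le> real (floor_log n) * ln 2"
    using half_le_ln[of 2] by (intro mult_left_mono) auto
  ultimately show ?thesis using half_le_ln[OF n] by simp
qed

definition enum :: "nat set set \<Rightarrow> nat set list" where
  "enum S = (SOME xs. set xs = S \<and> distinct xs)"

lemma enum: "finite S \<Longrightarrow> set (enum S) = S \<and> distinct (enum S)"
  unfolding enum_def by (rule someI_ex) (rule finite_distinct_list)

lemma finite_if_partial_clusters: "partial_clusters v S \<Longrightarrow> finite S"
  by (simp add: partial_clusters_def)

lemma partial_clusters_empty: "partial_clusters v {}"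
  by (simp add: partial_clusters_def)

text \<open>For \<open>fp = fm\<close> the gap vanishes and the quotient would be \<open>0\<close>; the value \<open>Suc n\<close> makes
  the algorithm query everything.\<close>

definition mc_threshold :: "nat \<Rightarrow> real pmf \<Rightarrow> real pmf \<Rightarrow> nat" where
  "mc_threshold n fp fm =
     (if fp = fm then Suc n else nat \<lceil>8 * ln (real n) / (gap fp fm)\<^sup>2\<rceil>)"

text \<open>At \<open>gap_point\<close> the values of \<open>fp\<close> and \<open>fm\<close> differ
  by exactly \<open>gap fp fm\<close>, so half of it is the midpoint test.\<close>

definition mc_accepts :: 
    "nat \<Rightarrow> real pmf \<Rightarrow> real pmf \<Rightarrow> (nat \<Rightarrow> nat \<Rightarrow> real) \<Rightarrow> nat \<Rightarrow> nat set \<Rightarrow> bool" where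
  "mc_accepts n fp fm W v c \<longleftrightarrow> card c \<ge> mc_threshold n fp fm \<and>
     \<bar>freq W v c (gap_point fp fm) - pmf fp (gap_point fp fm)\<bar> < gap fp fm / 2"

definition mc_skip :: "nat \<Rightarrow> real pmf \<Rightarrow> real pmf \<Rightarrow> (nat \<Rightarrow> nat \<Rightarrow> real) \<Rightarrow> nat \<Rightarrow> nat set set \<Rightarrow>
    nat set option" where
  "mc_skip n fp fm W v S = (if \<exists>c\<in>S. mc_accepts n fp fm W v c
     then Some (SOME c. c \<in> S \<and> mc_accepts n fp fm W v c) else None)"

lemma mc_skip_Some:
  assumes "mc_skip n fp fm W v S = Some c"
  shows "c \<in> S" "mc_accepts n fp fm W v c"
proof -
  have ex: "\<exists>c. c \<in> S \<and> mc_accepts n fp fm W v c"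
    using assms by (auto simp: mc_skip_def split: if_splits)
  moreover have "c = (SOME c. c \<in> S \<and> mc_accepts n fp fm W v c)"
    using assms by (auto simp: mc_skip_def split: if_splits)
  ultimately show "c \<in> S" "mc_accepts n fp fm W v c"
    using someI_ex[OF ex] by simp_all
qed

definition mc_tree :: "nat \<Rightarrow> real pmf \<Rightarrow> real pmf \<Rightarrow> (nat \<Rightarrow> nat \<Rightarrow> real) \<Rightarrow> qtree" where
  "mc_tree n fp fm W = cluster_tree (mc_skip n fp fm W) (\<lambda>c. card c \<ge> mc_threshold n fp fm)
     (\<lambda>v. enum) [1..<Suc n] {}"

lemma valid_mc_tree: "valid_qtree n (mc_tree n fp fm W)"
  unfolding mc_tree_def
  by (rule valid_cluster_tree)
    (auto dest: mc_skip_Some finite_if_partial_clusters simp: enum partial_clusters_empty)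

text \<open>Sup-distance between the row of \<open>v\<close> and that of the representative, both
  over \<open>c\<close>. Using one internal row keeps the reference a sample of independent entries,
  distributed as \<open>fp\<close> when \<open>c\<close> lies in a true cluster.\<close>

definition profile_dist :: "(nat \<Rightarrow> nat \<Rightarrow> real) \<Rightarrow> nat \<Rightarrow> nat set \<Rightarrow> real" where
  "profile_dist W v c = (SUP a. \<bar>freq W v c a - freq W (Min c) (c - {Min c}) a\<bar>)"

text \<open>Scales without a candidate are filtered out because \<open>arg_min_on\<close> is only
  meaningful on a nonempty set.\<close>

definition lv_guesses :: "nat \<Rightarrow> (nat \<Rightarrow> nat \<Rightarrow> real) \<Rightarrow> nat \<Rightarrow> nat set set \<Rightarrow> nat set list" where
  "lv_guesses n W v S = map (\<lambda>j. arg_min_on (profile_dist W v) {c \<in> S. 2 ^ j \<le> card c})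
     (filter (\<lambda>j. \<exists>c\<in>S. 2 ^ j \<le> card c) [0..<Suc (floor_log n)])"

text \<open>Appending all known clusters to the guesses makes the outcome correct for every matrix;
  the guesses affect the cost only.\<close>

definition lv_tree :: "nat \<Rightarrow> (nat \<Rightarrow> nat \<Rightarrow> real) \<Rightarrow> qtree" where
  "lv_tree n W = cluster_tree (\<lambda>_ _. None) (\<lambda>_. False)
     (\<lambda>v S. lv_guesses n W v S @ enum S) [1..<Suc n] {}"

lemma set_lv_guesses:
  assumes "finite S"
  shows "set (lv_guesses n W v S) \<subseteq> S"
proof
  fix c assume "c \<in> set (lv_guesses n W v S)"
  then obtain j where j: "\<exists>c\<in>S. 2 ^ j \<le> card c"
    and c: "c = arg_min_on (profile_dist W v) {c \<in> S. 2 ^ j \<le> card c}"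
    by (auto simp: lv_guesses_def simp del: upt_Suc)
  have "finite {c \<in> S. 2 ^ j \<le> card c}" "{c \<in> S. 2 ^ j \<le> card c} \<noteq> {}" using assms j by auto
  from arg_min_if_finite(1)[OF this] show "c \<in> S" using c by auto
qed

lemma length_lv_guesses: "length (lv_guesses n W v S) \<le> Suc (floor_log n)"
  using length_filter_le[of "\<lambda>j. \<exists>c\<in>S. 2 ^ j \<le> card c" "[0..<Suc (floor_log n)]"]
  by (simp add: lv_guesses_def del: upt_Suc)

lemma valid_lv_tree: "valid_qtree n (lv_tree n W)"
  unfolding lv_tree_def
  by (rule valid_cluster_tree)
    (auto dest!: finite_if_partial_clusters subsetD[OF set_lv_guesses, rotated]
      simp: enum partial_clusters_empty)

lemma profile_dist_ge: "\<bar>freq W v c a - freq W (Min c) (c - {Min c}) a\<bar> \<le> profile_dist W v c"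
  unfolding profile_dist_def
proof (rule cSUP_upper)
  have "\<bar>freq W v c a - freq W (Min c) (c - {Min c}) a\<bar> \<le> 1" for a
    using freq_nonneg[of W v c a] freq_le_1[of W v c a]
      freq_nonneg[of W "Min c" "c - {Min c}" a] freq_le_1[of W "Min c" "c - {Min c}" a] by linarith
  then show "bdd_above (range (\<lambda>a. \<bar>freq W v c a - freq W (Min c) (c - {Min c}) a\<bar>))"
    by (intro bdd_aboveI) auto
qed simp

lemma profile_dist_le:
  "(\<And>a. \<bar>freq W v c a - freq W (Min c) (c - {Min c}) a\<bar> \<le> x) \<Longrightarrow> profile_dist W v c \<le> x"
  unfolding profile_dist_def by (rule cSUP_least) auto

definition deviates :: "nat \<Rightarrow> nat set \<Rightarrow> real pmf \<Rightarrow> real \<Rightarrow> real \<Rightarrow> (nat \<Rightarrow> nat \<Rightarrow> real) set" where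
  "deviates v K f \<eta> a = {W. \<bar>freq W v K a - pmf f a\<bar> \<ge> \<eta>}"

text \<open>Index set of the union bounds. It involves true clusters only and so does not depend on
  the random matrix.\<close>

definition cluster_pairs :: "nat \<Rightarrow> nat set set \<Rightarrow> nat \<Rightarrow> (nat \<times> nat set) set" where
  "cluster_pairs n P m = {(v, C). v \<in> {1..n} \<and> C \<in> P \<and> m \<le> card (C \<inter> {1..<v})}"

text \<open>The union over all values in \<open>A\<close> is needed since the Las Vegas algorithm does not know the
  value realising the gap.\<close>

definition lv_bad :: 
    "nat \<Rightarrow> nat set set \<Rightarrow> real set \<Rightarrow> real pmf \<Rightarrow> real pmf \<Rightarrow> nat \<Rightarrow> (nat \<Rightarrow> nat \<Rightarrow> real) set" where
  "lv_bad n P A fp fm m = (\<Union>(v, C) \<in> cluster_pairs n P (Suc m). \<Union>a\<in>A.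
     deviates v (C \<inter> {1..<v}) (if v \<in> C then fp else fm) (gap fp fm / 4) a \<union>
     deviates (Min (C \<inter> {1..<v})) (C \<inter> {1..<v} - {Min (C \<inter> {1..<v})}) fp (gap fp fm / 4) a)"

subsection \<open>Analysis for a fixed clustering\<close>

context
  fixes n :: nat and P :: "nat set set"
  assumes part: "partition_on {1..n} P"
begin

section \<open>Traces of the true clusters and runs without mistakes\<close>

lemma partition_subset: "C \<in> P \<Longrightarrow> C \<subseteq> {1..n}"
  unfolding partition_onD1[OF part] by (rule Union_upper)

lemma finite_partition: "finite P"
  using part finite_elements[of "{1..n}" P] by simp

lemma partial_clusters_revealed: "partial_clusters v (revealed P v)"
  using finite_partition by (auto simp: partial_clusters_def revealed_def)

lemma revealed_Suc_n: "revealed P (Suc n) = P"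
proof -
  have "C \<inter> {1..<Suc n} = C" "C \<noteq> {}" if "C \<in> P" for C
    using partition_subset[OF that] partition_onD3[OF part] that by auto
  then have "(\<lambda>C. C \<inter> {1..<Suc n}) ` P = P" "{} \<notin> P" by auto
  then show ?thesis unfolding revealed_def by blast
qed

lemma card_revealed_le: "card (revealed P v) \<le> card P"
proof -
  have "card (revealed P v) \<le> card ((\<lambda>C. C \<inter> {1..<v}) ` P)"
    unfolding revealed_def using finite_partition by (intro card_mono) auto
  also have "\<dots> \<le> card P" using finite_partition by (rule card_image_le)
  finally show ?thesis .
qed

text \<open>The representative of a known cluster lies in exactly one true cluster, so a single
  query decides membership.\<close>

lemma revealed_match:
  assumes C: "C \<in> P" "v \<in> C" and c: "c \<in> revealed P v"
  shows "same_cluster P v (Min c) \<longleftrightarrow> c = C \<inter> {1..<v}"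
proof -
  obtain D where D: "D \<in> P" "c = D \<inter> {1..<v}" using c by (auto simp: revealed_def)
  have m: "Min c \<in> c" using Min_partial_clusters[OF partial_clusters_revealed c] by simp
  show ?thesis
    using m D partition_on_unique[OF part C(1) D(1)] same_cluster_iff[OF part C] by auto
qed

text \<open>Only the trace of the cluster of \<open>v\<close> changes. The two cases are the two
  state updates of \<open>cluster_tree\<close>.\<close>

lemma revealed_Suc:
  assumes C: "C \<in> P" "v \<in> C"
  shows "revealed P (Suc v) = (if C \<inter> {1..<v} = {} then insert {v} (revealed P v)
           else add_to v (C \<inter> {1..<v}) (revealed P v))"
proof -
  let ?r = "\<lambda>w D. D \<inter> {1..<w}"
  have v1: "v \<ge> 1" using C(2) partition_subset[OF C(1)] by auto
  have other: "?r (Suc v) D = ?r v D" if "D \<in> P" "D \<noteq> C" for D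
    using that C partition_on_unique[OF part that(1) C(1)] by (auto simp: less_Suc_eq)
  have own: "?r (Suc v) C = insert v (?r v C)" using C v1 by (auto simp: less_Suc_eq)
  have "revealed P (Suc v) = insert (?r (Suc v) C) (?r (Suc v) ` (P - {C})) - {{}}"
    using C(1) by (auto simp: revealed_def)
  also have "?r (Suc v) ` (P - {C}) = ?r v ` (P - {C})"
    using other by (intro image_cong) auto
  finally have Suc: "revealed P (Suc v) = insert (insert v (?r v C)) (?r v ` (P - {C}) - {{}})"
    using own by auto
  have "revealed P v = insert (?r v C) (?r v ` (P - {C})) - {{}}"
    using C(1) by (auto simp: revealed_def)
  \<comment> \<open>Nonempty traces of different clusters are different, so removing the trace of
    \<open>C\<close> from the state removes nothing else.\<close>
  moreover have "?r v C \<notin> ?r v ` (P - {C}) - {{}}"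
  proof
    assume "?r v C \<in> ?r v ` (P - {C}) - {{}}"
    then obtain D x where "D \<in> P" "D \<noteq> C" "?r v C = ?r v D" "x \<in> ?r v C" by blast
    then show False using partition_on_unique[OF part \<open>D \<in> P\<close> C(1), of x] by blast
  qed
  ultimately show ?thesis unfolding Suc add_to_def by (cases "?r v C = {}") auto
qed

text \<open>If \<open>skip\<close> and \<open>halt\<close> make no mistake on the states
  \<open>revealed P v\<close>, the run passes through exactly these states; the last one is
  \<open>P\<close>. Hence conditions on these states suffice.\<close>

lemma run_cluster_tree:
  assumes skip: "\<And>v C c. C \<in> P \<Longrightarrow> v \<in> C \<Longrightarrow> skip v (revealed P v) = Some c \<Longrightarrow>
        c \<in> revealed P v \<and> c = C \<inter> {1..<v}"
    and ord: "\<And>v. set (ord v (revealed P v)) = revealed P v"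
    and halt: "\<And>v C. C \<in> P \<Longrightarrow> v \<in> C \<Longrightarrow> skip v (revealed P v) = None \<Longrightarrow>
        C \<inter> {1..<v} \<noteq> {} \<Longrightarrow> \<not> halt (C \<inter> {1..<v})"
    and "1 \<le> v" "v \<le> Suc n"
  shows "run P (cluster_tree skip halt ord [v..<Suc n] (revealed P v)) = P \<and>
    num_queries P (cluster_tree skip halt ord [v..<Suc n] (revealed P v)) \<le>
       (\<Sum>u = v..n. ask_cost P u (ord u (revealed P u)))"
  using assms(5,4)
proof (induction v rule: inc_induct)
  case base
  show ?case using revealed_Suc_n by simp
next
  case (step v)
  let ?T = "\<lambda>S. cluster_tree skip halt ord [Suc v..<Suc n] S"
  let ?U = "cluster_tree skip halt ord [v..<Suc n] (revealed P v)"
  let ?q = "ask_cost P v (ord v (revealed P v))"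
  have "v \<in> \<Union>P" using step.hyps step.prems partition_onD1[OF part] by auto
  then obtain C where C: "C \<in> P" "v \<in> C" by blast
  have upt: "[v..<Suc n] = v # [Suc v..<Suc n]" using step by (simp add: upt_conv_Cons)
  have "run P ?U = run P (?T (revealed P (Suc v))) \<and>
      num_queries P ?U \<le> ?q + num_queries P (?T (revealed P (Suc v)))"
  proof (cases "skip v (revealed P v)")
    case (Some c)
    then have "c = C \<inter> {1..<v}" "c \<noteq> {}"
      using skip[OF C Some] by (auto simp: revealed_def)
    then show ?thesis using revealed_Suc[OF C] Some by (simp add: upt del: upt_Suc)
  next
    case None
    show ?thesis
    proof (cases "C \<inter> {1..<v} = {}")
      case True
      then have no: "\<not> same_cluster P v (Min d)" if "d \<in> set (ord v (revealed P v))" for d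
        using that revealed_match[OF C, of d] ord by (auto simp: revealed_def)
      show ?thesis
        using ask_not_found[OF no] None True revealed_Suc[OF C] by (simp add: upt del: upt_Suc)
    next
      case False
      let ?c = "C \<inter> {1..<v}"
      have c: "?c \<in> revealed P v" using False C by (auto simp: revealed_def)
      have found: "?c \<in> set (ord v (revealed P v))" "same_cluster P v (Min ?c)"
        "\<And>d. d \<in> set (ord v (revealed P v)) \<Longrightarrow> same_cluster P v (Min d) \<Longrightarrow> d = ?c"
        using c ord revealed_match[OF C] by auto
      show ?thesis
        using ask_found[OF found] None False revealed_Suc[OF C] halt[OF C None False]
        by (simp add: upt del: upt_Suc)
    qed
  qed
  moreover have "{v..n} = insert v {Suc v..n}" using step by auto
  ultimately show ?case using step.IH by simp
qed

section \<open>Query bound for every side information\<close>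

lemma card_separated_le:
  assumes "partial_clusters v S" "v \<le> Suc n" "separated P S"
  shows "card S \<le> card P"
proof (rule card_le_if_inj_on_rel[where r = "\<lambda>c C. Min c \<in> C"])
  fix c assume "c \<in> S"
  then have "Min c \<in> \<Union>P"
    using Min_partial_clusters(2)[OF assms(1), of c] assms(2)
    by (auto simp flip: partition_onD1[OF part])
  then show "\<exists>C. C \<in> P \<and> Min c \<in> C" by blast
next
  fix c d C assume "c \<in> S" "d \<in> S" "C \<in> P" "Min c \<in> C" "Min d \<in> C"
  then show "c = d" using assms(3) by (auto simp: separated_def same_cluster_def)
qed (rule finite_partition)

text \<open>Amortisation: a queried vertex costs at most \<open>card P\<close> queries and raises
  the potential by one, and the potential never exceeds \<open>card P * M\<close>. The summand
  \<open>1\<close> pays for the last vertex before giving up.\<close>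

lemma num_queries_cluster_tree_le:
  assumes skip: "\<And>v S c. partial_clusters v S \<Longrightarrow> skip v S = Some c \<Longrightarrow> c \<in> S"
    and ord: "\<And>v S. partial_clusters v S \<Longrightarrow> set (ord v S) = S \<and> distinct (ord v S)"
    and halt: "\<And>c. halt c \<longleftrightarrow> card c \<ge> M" and M: "M \<ge> 1"
    and "1 \<le> v" "v \<le> Suc n" "partial_clusters v S" "separated P S"
  shows "num_queries P (cluster_tree skip halt ord [v..<Suc n] S) +
      card P * (\<Sum>c\<in>S. min (card c) M) \<le> card P * (card P * M + 1)"
  using assms(6,5,7,8)
proof (induction v arbitrary: S rule: inc_induct)
  case base
  have "(\<Sum>c\<in>S. min (card c) M) \<le> card S * M"
    using sum_bounded_above[of S "\<lambda>c. min (card c) M" M] by simp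
  also have "\<dots> \<le> card P * M" using card_separated_le base by (intro mult_right_mono) auto
  finally have "card P * (\<Sum>c\<in>S. min (card c) M) \<le> card P * (card P * M)" by (rule mult_le_mono2)
  then show ?case by (simp add: trans_le_add2)
next
  case (step v)
  let ?T = "\<lambda>S. cluster_tree skip halt ord [Suc v..<Suc n] S"
  let ?U = "cluster_tree skip halt ord [v..<Suc n] S"
  let ?\<Phi> = "\<lambda>S. \<Sum>c\<in>S. min (card c) M"
  let ?q = "ask_cost P v (ord v S)"
  let ?B = "card P * (card P * M + 1)"
  have upt: "[v..<Suc n] = v # [Suc v..<Suc n]" using step by (simp add: upt_conv_Cons)
  have cardS: "card S \<le> card P"
    using card_separated_le[of v S] step.hyps step.prems by simp
  have "?\<Phi> S \<le> card S * M"
    using sum_bounded_above[of S "\<lambda>c. min (card c) M" M] by simp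
  also have "\<dots> \<le> card P * M" using cardS by (rule mult_right_mono) simp
  finally have \<Phi>: "?\<Phi> S \<le> card P * M" .
  have "?q \<le> length (ord v S)" by (rule ask_cost_le_length)
  also have "\<dots> = card S" using ord[OF step.prems(2)] distinct_card by fastforce
  finally have q: "?q \<le> card P" using cardS by simp
  have join: "num_queries P (?T (add_to v c S)) + card P * ?\<Phi> (add_to v c S) \<le> ?B" if "c \<in> S" for c
    using that step.prems
    by (intro step.IH partial_clusters_join separated_join) auto
  show ?case
  proof (cases "skip v S")
    case (Some c)
    then have c: "c \<in> S" using skip step.prems by blast
    have "min (card c) M \<le> min (Suc (card c)) M" by (simp add: min_def)
    then have "?\<Phi> S \<le> ?\<Phi> (add_to v c S)" using potential_join[OF step.prems(2) c, of M] by linarith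
    then have "card P * ?\<Phi> S \<le> card P * ?\<Phi> (add_to v c S)" by (rule mult_le_mono2)
    moreover have "num_queries P ?U = num_queries P (?T (add_to v c S))"
      using Some by (simp add: upt del: upt_Suc)
    ultimately show ?thesis using join[OF c] by linarith
  next
    case None
    show ?thesis
    proof (cases "\<exists>c\<in>S. same_cluster P v (Min c)")
      case True
      then obtain c where c: "c \<in> S" "same_cluster P v (Min c)" by blast
      have v: "v \<in> \<Union>P" using step.hyps step.prems partition_onD1[OF part] by auto
      then obtain C where C: "C \<in> P" "v \<in> C" by blast
      have uniq: "d = c" if "d \<in> set (ord v S)" "same_cluster P v (Min d)" for d
        using that c ord[OF step.prems(2)] same_cluster_iff[OF part C] C(1) step.prems(3)
        by (auto simp: separated_def same_cluster_def)
      have num: "num_queries P ?U =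
          ?q + num_queries P (if halt c then Output {} else ?T (add_to v c S))"
        using ask_found[of c "ord v S", OF _ c(2) uniq] c(1) ord[OF step.prems(2)] None
        by (simp add: upt del: upt_Suc)
      show ?thesis
      proof (cases "halt c")
        \<comment> \<open>Giving up: the potential does not grow, but no query follows.\<close>
        case True
        have "num_queries P ?U + card P * ?\<Phi> S \<le> card P + card P * (card P * M)"
          using num True q \<Phi> by (intro add_mono mult_le_mono2) auto
        then show ?thesis by (simp add: algebra_simps)
      next
        case False
        \<comment> \<open>Without halting, \<open>c\<close> has fewer than \<open>M\<close> members,
          so the cap is not reached and the potential really grows.\<close>
        then have "min (Suc (card c)) M = Suc (min (card c) M)" using halt by auto
        then have "?\<Phi> (add_to v c S) = Suc (?\<Phi> S)"
          using potential_join[OF step.prems(2) c(1), of M] by simp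
        then show ?thesis using num False q join[OF c(1)] by simp
      qed
    next
      case False
      have num: "num_queries P ?U = ?q + num_queries P (?T (insert {v} S))"
        using ask_not_found(2)[of "ord v S" P v] False ord[OF step.prems(2)] None
        by (simp add: upt del: upt_Suc)
      have "num_queries P (?T (insert {v} S)) + card P * ?\<Phi> (insert {v} S) \<le> ?B"
        using step.prems False by (intro step.IH partial_clusters_new separated_new) auto
      then show ?thesis using num q potential_new[OF step.prems(2) M] by simp
    qed
  qed
qed

section \<open>Deviation probabilities for vertices and true clusters\<close>

lemma card_partition_le: "card P \<le> n"
proof -
  have "card P \<le> card {1..n}"
  proof (rule card_le_if_inj_on_rel[where r = "\<lambda>C x. x \<in> C"])
    fix C assume "C \<in> P"
    then show "\<exists>x. x \<in> {1..n} \<and> x \<in> C"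
      using partition_subset partition_onD3[OF part] by (metis equals0I subsetD)
  qed (use partition_on_unique[OF part] in auto)
  then show ?thesis by simp
qed

lemma finite_cluster_pairs: "finite (cluster_pairs n P m)"
  and card_cluster_pairs: "card (cluster_pairs n P m) \<le> n * n"
proof -
  have sub: "cluster_pairs n P m \<subseteq> {1..n} \<times> P" by (auto simp: cluster_pairs_def)
  have fin: "finite ({1..n} \<times> P)" using finite_partition by simp
  show "finite (cluster_pairs n P m)" using sub fin by (rule finite_subset)
  have "card (cluster_pairs n P m) \<le> card ({1..n} \<times> P)" using fin sub by (rule card_mono)
  also have "\<dots> = n * card P" by (simp add: card_cartesian_product)
  also have "\<dots> \<le> n * n" using card_partition_le by simp
  finally show "card (cluster_pairs n P m) \<le> n * n" .
qed

text \<open>The earlier members of \<open>C\<close> all relate to \<open>v\<close> in the same way,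
  and they form a fixed set, so the concentration bound applies.\<close>

lemma prob_deviates:
  assumes q: "(v, C) \<in> cluster_pairs n P m" and m: "m \<ge> 1" and \<eta>: "\<eta> \<ge> 0"
  shows "measure_pmf.prob (side_info n P fp fm)
     (deviates v (C \<inter> {1..<v}) (if v \<in> C then fp else fm) \<eta> a) \<le> 2 * exp (- (2 * real m * \<eta>\<^sup>2))"
proof -
  let ?c = "C \<inter> {1..<v}"
  have v: "v \<in> {1..n}" and C: "C \<in> P" and m': "m \<le> card ?c"
    using q by (auto simp: cluster_pairs_def)
  have "measure_pmf.prob (side_info n P fp fm)
     (deviates v ?c (if v \<in> C then fp else fm) \<eta> a) \<le> 2 * exp (- 2 * real (card ?c) * \<eta>\<^sup>2)"
    unfolding deviates_def
  proof (rule side_info_frequency_concentration[OF v _ _ _ _ \<eta>])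
    show "?c \<subseteq> {1..n}" using partition_subset[OF C] by auto
    show "?c \<noteq> {}" using m' m by auto
    fix u assume "u \<in> ?c"
    then show "same_cluster P v u \<longleftrightarrow> v \<in> C"
      using same_cluster_iff[OF part C, of u v] same_cluster_sym[of P u v] by simp
  qed simp
  also have "\<dots> \<le> 2 * exp (- (2 * real m * \<eta>\<^sup>2))"
    using m' by (auto intro: mult_right_mono)
  finally show ?thesis .
qed

text \<open>Leaving out the representative costs one sample, hence \<open>Suc m\<close> in the
  hypothesis.\<close>

lemma prob_profile_deviates:
  assumes q: "(v, C) \<in> cluster_pairs n P (Suc m)" and m: "m \<ge> 1" and \<eta>: "\<eta> \<ge> 0"
  shows "measure_pmf.prob (side_info n P fp fm)
     (deviates (Min (C \<inter> {1..<v})) (C \<inter> {1..<v} - {Min (C \<inter> {1..<v})}) fp \<eta> a)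
     \<le> 2 * exp (- (2 * real m * \<eta>\<^sup>2))"
proof -
  let ?c = "C \<inter> {1..<v}"
  let ?r = "Min ?c"
  have v: "v \<in> {1..n}" and C: "C \<in> P" and m': "Suc m \<le> card ?c"
    using q by (auto simp: cluster_pairs_def)
  have "?c \<noteq> {}" using m' by auto
  then have r: "?r \<in> ?c" by (intro Min_in) auto
  then have card: "card (?c - {?r}) \<ge> m" using m' by simp
  have "measure_pmf.prob (side_info n P fp fm)
     (deviates ?r (?c - {?r}) (if True then fp else fm) \<eta> a) \<le> 2 * exp (- 2 * real (card (?c - {?r})) * \<eta>\<^sup>2)"
    unfolding deviates_def
  proof (rule side_info_frequency_concentration[OF _ _ _ _ _ \<eta>])
    show "?r \<in> {1..n}" using r partition_subset[OF C] by blast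
    show "?c - {?r} \<subseteq> {1..n}" using partition_subset[OF C] by auto
    show "?c - {?r} \<noteq> {}" using card m by (metis card.empty not_one_le_zero order_trans)
    fix u assume "u \<in> ?c - {?r}"
    then show "same_cluster P ?r u \<longleftrightarrow> True"
      using same_cluster_iff[OF part C, of ?r u] r by simp
  qed simp
  also have "\<dots> \<le> 2 * exp (- (2 * real m * \<eta>\<^sup>2))"
    using card by (auto intro: mult_right_mono)
  finally show ?thesis by simp
qed

section \<open>Outcome and cost of individual runs\<close>

lemma run_mc_tree:
  assumes "W \<notin> (\<Union>(v, C) \<in> cluster_pairs n P (mc_threshold n fp fm).
    deviates v (C \<inter> {1..<v}) (if v \<in> C then fp else fm) (gap fp fm / 2) (gap_point fp fm))"
  shows "run P (mc_tree n fp fm W) = P"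
proof -
  let ?M = "mc_threshold n fp fm"
  let ?a = "gap_point fp fm"
  have accepts: "mc_accepts n fp fm W v (C \<inter> {1..<v}) \<longleftrightarrow> v \<in> C"
    if "C \<in> P" "v \<in> {1..n}" "?M \<le> card (C \<inter> {1..<v})" for v C
  proof -
    have "\<bar>freq W v (C \<inter> {1..<v}) ?a - pmf (if v \<in> C then fp else fm) ?a\<bar> < gap fp fm / 2"
      using assms that by (fastforce simp: cluster_pairs_def deviates_def)
    \<comment> \<open>By the triangle inequality, no frequency is within half the gap of both
      values.\<close>
    moreover have "\<bar>x - pmf fp ?a\<bar> \<ge> gap fp fm / 2" if "\<bar>x - pmf fm ?a\<bar> < gap fp fm / 2" for x
    proof -
      have "gap fp fm \<le> \<bar>x - pmf fm ?a\<bar> + \<bar>x - pmf fp ?a\<bar>"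
        using abs_triangle_ineq4[of "x - pmf fm ?a" "x - pmf fp ?a"] by (simp add: gap_def)
      then show ?thesis using that by simp
    qed
    ultimately show ?thesis using that(3) by (cases "v \<in> C") (auto simp: mc_accepts_def not_less)
  qed
  have "run P (cluster_tree (mc_skip n fp fm W) (\<lambda>c. card c \<ge> ?M) (\<lambda>v. enum) [1..<Suc n] (revealed P 1)) = P \<and>
      num_queries P (cluster_tree (mc_skip n fp fm W) (\<lambda>c. card c \<ge> ?M) (\<lambda>v. enum) [1..<Suc n] (revealed P 1))
        \<le> (\<Sum>u = 1..n. ask_cost P u (enum (revealed P u)))"
  proof (rule run_cluster_tree)
    fix v C c assume C: "C \<in> P" "v \<in> C" and skip: "mc_skip n fp fm W v (revealed P v) = Some c"
    note c = mc_skip_Some[OF skip]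
    obtain D where D: "D \<in> P" "c = D \<inter> {1..<v}" using c(1) by (auto simp: revealed_def)
    have "v \<in> {1..n}" using C partition_subset[OF C(1)] by blast
    then have "v \<in> D" using accepts[OF D(1)] c(2) D(2) by (auto simp: mc_accepts_def)
    then have "D = C" using partition_on_unique[OF part D(1) C(1)] C(2) by blast
    then show "c \<in> revealed P v \<and> c = C \<inter> {1..<v}" using c(1) D(2) by blast
  next
    fix v show "set (enum (revealed P v)) = revealed P v"
      using enum finite_if_partial_clusters[OF partial_clusters_revealed] by blast
  next
    fix v C assume C: "C \<in> P" "v \<in> C" and skip: "mc_skip n fp fm W v (revealed P v) = None"
      and ne: "C \<inter> {1..<v} \<noteq> {}"
    have v: "v \<in> {1..n}" using C partition_subset[OF C(1)] by blast
    have "C \<inter> {1..<v} \<in> revealed P v" using C ne by (auto simp: revealed_def)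
    then have "\<not> mc_accepts n fp fm W v (C \<inter> {1..<v})"
      using skip by (auto simp: mc_skip_def split: if_splits)
    \<comment> \<open>A large trace of the cluster of \<open>v\<close> would have been accepted, so
      \<open>halt\<close> cannot fire.\<close>
    then show "\<not> ?M \<le> card (C \<inter> {1..<v})" using accepts[OF C(1) v] C(2) by blast
  qed auto
  then show ?thesis unfolding mc_tree_def revealed_1 by blast
qed

lemma run_lv_tree:
  "run P (lv_tree n W) = P \<and> num_queries P (lv_tree n W) \<le>
     (\<Sum>v = 1..n. ask_cost P v (lv_guesses n W v (revealed P v) @ enum (revealed P v)))"
proof -
  have fin: "finite (revealed P v)" for v
    using finite_if_partial_clusters[OF partial_clusters_revealed] .
  have "run P (cluster_tree (\<lambda>_ _. None) (\<lambda>_. False) (\<lambda>v S. lv_guesses n W v S @ enum S)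
      [1..<Suc n] (revealed P 1)) = P \<and>
    num_queries P (cluster_tree (\<lambda>_ _. None) (\<lambda>_. False) (\<lambda>v S. lv_guesses n W v S @ enum S)
      [1..<Suc n] (revealed P 1)) \<le>
     (\<Sum>v = 1..n. ask_cost P v (lv_guesses n W v (revealed P v) @ enum (revealed P v)))"
   
    by (rule run_cluster_tree) (use enum[OF fin] in \<open>auto dest!: subsetD[OF set_lv_guesses[OF fin]]\<close>)
  then show ?thesis unfolding lv_tree_def revealed_1 .
qed

lemma ask_cost_lv_le:
  "ask_cost P v (lv_guesses n W v (revealed P v) @ enum (revealed P v)) \<le> Suc (floor_log n) + card P"
proof -
  have "finite (revealed P v)"
    using finite_if_partial_clusters[OF partial_clusters_revealed] .
  then have "length (enum (revealed P v)) = card (revealed P v)"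
    using enum distinct_card by metis
  then show ?thesis
    using ask_cost_le_length[of P v "lv_guesses n W v (revealed P v) @ enum (revealed P v)"]
      length_lv_guesses[of n W v "revealed P v"] card_revealed_le[of v] by simp
qed

text \<open>The worst case, charged on the bad event only.\<close>

lemma num_queries_lv_tree_le: "num_queries P (lv_tree n W) \<le> n * (Suc (floor_log n) + card P)"
proof -
  have "num_queries P (lv_tree n W) \<le>
     (\<Sum>v = 1..n. ask_cost P v (lv_guesses n W v (revealed P v) @ enum (revealed P v)))"
    using run_lv_tree by blast
  also have "\<dots> \<le> (\<Sum>v = 1..n. Suc (floor_log n) + card P)"
    by (intro sum_mono ask_cost_lv_le)
  finally show ?thesis by simp
qed

text \<open>Within a cluster the number of earlier members is an injective rank, so fewer than
  \<open>m\<close> earlier members occur for at most \<open>m\<close> vertices.\<close>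

lemma card_early_vertices:
  "card (\<Union>C\<in>P. {v \<in> C. card (C \<inter> {1..<v}) < m}) \<le> card P * m"
proof -
  have one: "card {v \<in> C. card (C \<inter> {1..<v}) < m} \<le> m" if C: "C \<in> P" for C
  proof -
    have "inj_on (\<lambda>v. card (C \<inter> {1..<v})) C"
    proof (rule linorder_inj_onI)
      fix u v assume uv: "u < v" "u \<in> C" "v \<in> C"
      then have "u \<ge> 1" using partition_subset[OF C] by auto
      then have "C \<inter> {1..<u} \<subset> C \<inter> {1..<v}" using uv by auto
      then have "card (C \<inter> {1..<u}) < card (C \<inter> {1..<v})" by (intro psubset_card_mono) auto
      then show "card (C \<inter> {1..<u}) \<noteq> card (C \<inter> {1..<v})" by simp
    qed auto
    then have "card {v \<in> C. card (C \<inter> {1..<v}) < m} \<le> card {..<m}"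
      by (intro card_inj_on_le[where f = "\<lambda>v. card (C \<inter> {1..<v})"]) (auto intro: inj_on_subset)
    then show ?thesis by simp
  qed
  have "card (\<Union>C\<in>P. {v \<in> C. card (C \<inter> {1..<v}) < m}) \<le>
      (\<Sum>C\<in>P. card {v \<in> C. card (C \<inter> {1..<v}) < m})"
    using finite_partition by (rule card_UN_le)
  also have "\<dots> \<le> card P * m" using sum_bounded_above[of P _ m] one by simp
  finally show ?thesis .
qed

context
  fixes fp fm :: "real pmf" and \<epsilon> :: real and A :: "real set"
  assumes adm: "admissible \<epsilon> A fp fm" and \<epsilon>: "\<epsilon> > 0"
begin

section \<open>Monte Carlo bounds in terms of the divergence\<close>

lemma gap_pos:
  assumes "fp \<noteq> fm"
  shows "gap fp fm > 0"
proof -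
  note s = admissible_support[OF adm \<epsilon>]
  obtain a where "pmf fp a \<noteq> pmf fm a" using assms by (auto simp: pmf_eq_iff)
  then have "0 < \<bar>pmf fp a - pmf fm a\<bar>" by simp
  also have "\<dots> \<le> gap fp fm" using gap_ge[of fp fm a] s by simp
  finally show ?thesis .
qed

lemma mc_threshold_bounds:
  assumes "fp \<noteq> fm" "n \<ge> 2"
  shows "8 * ln (real n) \<le> real (mc_threshold n fp fm) * (gap fp fm)\<^sup>2"
    "real (mc_threshold n fp fm) \<le> 8 * ln (real n) / (gap fp fm)\<^sup>2 + 1"
    "mc_threshold n fp fm \<ge> 1"
proof -
  let ?x = "8 * ln (real n) / (gap fp fm)\<^sup>2"
  have g: "(gap fp fm)\<^sup>2 > 0" using gap_pos assms by simp
  have pos: "?x > 0" using half_le_ln[OF assms(2)] g by (intro divide_pos_pos) auto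
  have M: "mc_threshold n fp fm = nat \<lceil>?x\<rceil>" using assms by (simp add: mc_threshold_def)
  have "?x \<le> real (mc_threshold n fp fm)" unfolding M by (rule real_nat_ceiling_ge)
  then show "8 * ln (real n) \<le> real (mc_threshold n fp fm) * (gap fp fm)\<^sup>2"
    using g by (simp add: pos_divide_le_eq)
  show "real (mc_threshold n fp fm) \<le> ?x + 1" unfolding M using pos by linarith
  show "mc_threshold n fp fm \<ge> 1" unfolding M using pos by linarith
qed

lemma prob_mc_tree_correct:
  assumes "n \<ge> 1"
  shows "measure_pmf.prob (side_info n P fp fm) {W. run P (mc_tree n fp fm W) = P} \<ge> 1 - 1 / real n"
proof (cases "n \<ge> 2")
  case False
  then have "n = 1" using assms by simp
  then show ?thesis by simp
next
  case n: True
  let ?M = "mc_threshold n fp fm"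
  define Bad where "Bad = (\<Union>(v, C) \<in> cluster_pairs n P ?M.
    deviates v (C \<inter> {1..<v}) (if v \<in> C then fp else fm) (gap fp fm / 2) (gap_point fp fm))"
  have "measure_pmf.prob (side_info n P fp fm) Bad \<le> 1 / real n"
  proof (cases "fp = fm")
    case True
    \<comment> \<open>For equal distributions the threshold \<open>Suc n\<close> is never reached,
      so there is no bad event.\<close>
    have "card (C \<inter> {1..<v}) \<le> n" if "C \<in> P" for C v
      using card_mono[of "{1..n}" "C \<inter> {1..<v}"] partition_subset[OF that] by auto
    then have "\<not> Suc n \<le> card (C \<inter> {1..<v})" if "C \<in> P" for C v
      using that by (simp add: not_less_eq_eq)
    then have "cluster_pairs n P ?M = {}"
      using True by (auto simp: cluster_pairs_def mc_threshold_def)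
    then show ?thesis by (simp add: Bad_def)
  next
    case False
    note M = mc_threshold_bounds[OF False n]
    have "measure_pmf.prob (side_info n P fp fm) Bad \<le>
        real (card (cluster_pairs n P ?M)) * (2 * exp (- (2 * real ?M * (gap fp fm / 2)\<^sup>2)))"
      unfolding Bad_def
    proof (rule prob_UNION_le_card[OF finite_cluster_pairs], clarify)
      fix v C assume "(v, C) \<in> cluster_pairs n P ?M"
      then show "measure_pmf.prob (side_info n P fp fm) (deviates v (C \<inter> {1..<v})
          (if v \<in> C then fp else fm) (gap fp fm / 2) (gap_point fp fm))
        \<le> 2 * exp (- (2 * real ?M * (gap fp fm / 2)\<^sup>2))"
        using M(3) gap_nonneg[of fp fm] by (intro prob_deviates) auto
    qed
    also have "\<dots> \<le> real (n * n) * (2 * (1 / real n ^ 4))"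
    proof (rule mult_mono)
      show "real (card (cluster_pairs n P ?M)) \<le> real (n * n)"
        using card_cluster_pairs of_nat_le_iff by blast
      \<comment> \<open>The halved gap turns the constant 8 of the threshold into the exponent 4:
        two powers of \<open>n\<close> pay for the pairs, one more for the factor 2.\<close>
      have "real 4 * ln (real n) \<le> 2 * real ?M * (gap fp fm / 2)\<^sup>2"
        using M(1) by (simp add: power_divide)
      then have "exp (- (2 * real ?M * (gap fp fm / 2)\<^sup>2)) \<le> 1 / real n ^ 4"
        by (rule exp_neg_mult_ln_le[OF assms])
      then show "2 * exp (- (2 * real ?M * (gap fp fm / 2)\<^sup>2)) \<le> 2 * (1 / real n ^ 4)" by simp
    qed auto
    also have "\<dots> \<le> 1 / real n"
    proof -
      have "2 * real n \<le> real n * real n" using n by (intro mult_right_mono) auto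
      then show ?thesis using n by (simp add: field_simps power4_eq_xxxx)
    qed
    finally show ?thesis .
  qed
  moreover have "measure_pmf.prob (side_info n P fp fm) (UNIV - Bad)
      \<le> measure_pmf.prob (side_info n P fp fm) {W. run P (mc_tree n fp fm W) = P}"
    using run_mc_tree by (intro measure_pmf.finite_measure_mono) (auto simp: Bad_def)
  moreover have "measure_pmf.prob (side_info n P fp fm) (UNIV - Bad) =
      1 - measure_pmf.prob (side_info n P fp fm) Bad"
    using measure_pmf.prob_compl[of Bad "side_info n P fp fm"] by simp
  ultimately show ?thesis by linarith
qed

text \<open>All follow from \<open>sym_kl_le_gap\<close>. The last one, by
  \<open>gap \<le> 1\<close> and \<open>ln n \<ge> 1 / 2\<close>, lets rounding errors be charged to
  the main term.\<close>

lemma sym_kl_pos_bounds: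
  assumes "sym_kl fp fm > 0" "n \<ge> 2"
  shows "fp \<noteq> fm" "gap fp fm > 0"
    "1 / (gap fp fm)\<^sup>2 \<le> 1 / (\<epsilon>\<^sup>2 * sym_kl fp fm)"
    "1 \<le> 2 * (ln (real n) / (\<epsilon>\<^sup>2 * sym_kl fp fm))"
proof -
  have kl: "sym_kl fp fm \<le> (gap fp fm)\<^sup>2 / \<epsilon>\<^sup>2" by (rule sym_kl_le_gap[OF adm \<epsilon>])
  then have g0: "gap fp fm \<noteq> 0" using assms(1) by auto
  then show g: "gap fp fm > 0" using gap_nonneg[of fp fm] by linarith
  show "fp \<noteq> fm" using g0 by (auto simp: gap_def)
  have le: "\<epsilon>\<^sup>2 * sym_kl fp fm \<le> (gap fp fm)\<^sup>2" using kl \<epsilon> by (simp add: field_simps)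
  have pos: "\<epsilon>\<^sup>2 * sym_kl fp fm > 0" using \<epsilon> assms(1) by simp
  show "1 / (gap fp fm)\<^sup>2 \<le> 1 / (\<epsilon>\<^sup>2 * sym_kl fp fm)"
    using le pos g by (intro divide_left_mono) auto
  have "(gap fp fm)\<^sup>2 \<le> 1" using gap_nonneg gap_le_1 by (intro power_le_one)
  then have "\<epsilon>\<^sup>2 * sym_kl fp fm \<le> 2 * ln (real n)" using le half_le_ln[OF assms(2)] by linarith
  then show "1 \<le> 2 * (ln (real n) / (\<epsilon>\<^sup>2 * sym_kl fp fm))" using pos by (simp add: pos_le_divide_eq)
qed

lemma num_queries_mc_tree_le:
  assumes "sym_kl fp fm > 0" "n \<ge> 1"
  shows "real (num_queries P (mc_tree n fp fm W))
    \<le> 12 / \<epsilon>\<^sup>2 * ((real (card P))\<^sup>2 * ln (real n) / sym_kl fp fm)"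
proof (cases "n \<ge> 2")
  case False
  \<comment> \<open>The bound is 0 here, and indeed the first vertex meets no known cluster.\<close>
  then have "n = 1" using assms by simp
  moreover have "enum {} = []" using enum[of "{}"] by simp
  ultimately show ?thesis by (simp add: mc_tree_def mc_skip_def)
next
  case n: True
  let ?M = "mc_threshold n fp fm"
  let ?k = "real (card P)"
  let ?z = "ln (real n) / (\<epsilon>\<^sup>2 * sym_kl fp fm)"
  note bounds = sym_kl_pos_bounds[OF assms(1) n]
  note M = mc_threshold_bounds[OF bounds(1) n]
  have "num_queries P (mc_tree n fp fm W) + card P * (\<Sum>c\<in>({} :: nat set set). min (card c) ?M)
      \<le> card P * (card P * ?M + 1)"
    unfolding mc_tree_def
    by (rule num_queries_cluster_tree_le)
      (use M(3) in \<open>auto dest: mc_skip_Some finite_if_partial_clusters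
        simp: enum partial_clusters_empty separated_def\<close>)
  then have "real (num_queries P (mc_tree n fp fm W)) \<le> real (card P * (card P * ?M + 1))"
    by (simp only: of_nat_le_iff)
  also have "\<dots> = ?k * ?k * real ?M + ?k * 1" by (simp add: algebra_simps)
  also have "\<dots> \<le> ?k * ?k * real ?M + ?k * ?k"
    using le_square[of "card P"] by (simp flip: of_nat_mult)
  also have "\<dots> = ?k\<^sup>2 * (real ?M + 1)" by (simp add: algebra_simps power2_eq_square)
  also have "\<dots> \<le> ?k\<^sup>2 * (12 * ?z)"
  proof (intro mult_left_mono)
    have "8 * ln (real n) * (1 / (gap fp fm)\<^sup>2) \<le> 8 * ln (real n) * (1 / (\<epsilon>\<^sup>2 * sym_kl fp fm))"
      using bounds(3) half_le_ln[OF n] by (intro mult_left_mono) auto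
    \<comment> \<open>The constant 12 is 8 plus two units, one for rounding and one for the last
      vertex, each at most \<open>2 * ?z\<close>.\<close>
    then have "real ?M \<le> 8 * ?z + 1" using M(2) by simp
    then show "real ?M + 1 \<le> 12 * ?z" using bounds(4) by linarith
  qed simp
  finally show ?thesis by (simp add: mult_ac)
qed

section \<open>Las Vegas bounds in terms of the divergence\<close>

lemma prob_lv_bad:
  assumes m: "m \<ge> 1" "24 * ln (real n) \<le> real m * (gap fp fm)\<^sup>2" and n: "n \<ge> 1"
  shows "measure_pmf.prob (side_info n P fp fm) (lv_bad n P A fp fm m) \<le> 4 / (\<epsilon> * real n)"
proof -
  note s = admissible_support[OF adm \<epsilon>]
  let ?Q = "cluster_pairs n P (Suc m)"
  let ?e = "exp (- (2 * real m * (gap fp fm / 4)\<^sup>2))"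
  have "measure_pmf.prob (side_info n P fp fm) (lv_bad n P A fp fm m)
      \<le> real (card ?Q) * (real (card A) * (4 * ?e))"
    unfolding lv_bad_def
  proof (rule prob_UNION_le_card[OF finite_cluster_pairs], clarify)
    fix v C assume q: "(v, C) \<in> ?Q"
    let ?D1 = "\<lambda>a. deviates v (C \<inter> {1..<v}) (if v \<in> C then fp else fm) (gap fp fm / 4) a"
    let ?D2 = "\<lambda>a. deviates (Min (C \<inter> {1..<v})) (C \<inter> {1..<v} - {Min (C \<inter> {1..<v})}) fp (gap fp fm / 4) a"
    show "measure_pmf.prob (side_info n P fp fm) (\<Union>a\<in>A. ?D1 a \<union> ?D2 a) \<le> real (card A) * (4 * ?e)"
    proof (rule prob_UNION_le_card)
      fix a
      have "(v, C) \<in> cluster_pairs n P m" using q by (auto simp: cluster_pairs_def)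
      then have 1: "measure_pmf.prob (side_info n P fp fm) (?D1 a) \<le> 2 * ?e"
        using m gap_nonneg[of fp fm] by (intro prob_deviates) auto
      have 2: "measure_pmf.prob (side_info n P fp fm) (?D2 a) \<le> 2 * ?e"
        using m gap_nonneg[of fp fm] q by (intro prob_profile_deviates) auto
      have "measure_pmf.prob (side_info n P fp fm) (?D1 a \<union> ?D2 a)
          \<le> measure_pmf.prob (side_info n P fp fm) (?D1 a) + measure_pmf.prob (side_info n P fp fm) (?D2 a)"
        by (rule measure_Un_le) auto
      then show "measure_pmf.prob (side_info n P fp fm) (?D1 a \<union> ?D2 a) \<le> 4 * ?e"
        using 1 2 by linarith
    qed (rule s)
  qed
  also have "\<dots> \<le> real (n * n) * (real (card A) * (4 * (1 / real n ^ 3)))"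
  proof (intro mult_mono mult_left_mono)
    show "real (card ?Q) \<le> real (n * n)"
      using card_cluster_pairs[of "Suc m"] by (simp only: of_nat_le_iff)
    \<comment> \<open>The quartered gap turns 24 into the exponent 3: after the \<open>n * n\<close>
      pairs a factor \<open>1 / n\<close> remains, enough to offset the worst-case cost.\<close>
    have "real 3 * ln (real n) \<le> 2 * real m * (gap fp fm / 4)\<^sup>2"
      using m(2) by (simp add: power_divide)
    then show "?e \<le> 1 / real n ^ 3" by (rule exp_neg_mult_ln_le[OF n])
  qed auto
  also have "\<dots> = 4 * (real (card A) * \<epsilon>) / (\<epsilon> * real n)"
    using n \<epsilon> by (simp add: field_simps power3_eq_cube)
  also have "\<dots> \<le> 4 / (\<epsilon> * real n)"
    using admissible_card[OF adm \<epsilon>] \<epsilon> n by (intro divide_right_mono) auto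
  finally show ?thesis .
qed

text \<open>Both profiles are within a quarter of the gap of their true laws. So they differ by at
  most half the gap if the laws agree, and by more than half at \<open>gap_point\<close>
  otherwise.\<close>

lemma profile_dist_separates:
  assumes W: "W \<in> set_pmf (side_info n P fp fm)" "W \<notin> lv_bad n P A fp fm m" and gap: "gap fp fm > 0"
    and vC: "(v, C) \<in> cluster_pairs n P (Suc m)"
  shows "profile_dist W v (C \<inter> {1..<v}) \<le> gap fp fm / 2 \<longleftrightarrow> v \<in> C"
proof -
  note s = admissible_support[OF adm \<epsilon>]
  let ?c = "C \<inter> {1..<v}"
  let ?r = "Min ?c"
  let ?a = "gap_point fp fm"
  have v: "v \<in> {1..n}" and C: "C \<in> P" and "Suc m \<le> card ?c"
    using vC by (auto simp: cluster_pairs_def)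
  then have "?c \<noteq> {}" by auto
  then have r: "?r \<in> ?c" by (intro Min_in) auto
  have sub: "?c \<subseteq> {1..n}" using partition_subset[OF C] by auto
  have near: "\<bar>freq W v ?c a - pmf (if v \<in> C then fp else fm) a\<bar> < gap fp fm / 4"
      "\<bar>freq W ?r (?c - {?r}) a - pmf fp a\<bar> < gap fp fm / 4" if "a \<in> A" for a
  proof -
    have "W \<in> lv_bad n P A fp fm m" if "W \<in> deviates v ?c (if v \<in> C then fp else fm) (gap fp fm / 4) a \<union>
        deviates ?r (?c - {?r}) fp (gap fp fm / 4) a"
      unfolding lv_bad_def
      by (rule UN_I[OF vC]) (use that \<open>a \<in> A\<close> in blast)
    then have "W \<notin> deviates v ?c (if v \<in> C then fp else fm) (gap fp fm / 4) a \<union>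
        deviates ?r (?c - {?r}) fp (gap fp fm / 4) a"
      using W(2) by blast
    then show "\<bar>freq W v ?c a - pmf (if v \<in> C then fp else fm) a\<bar> < gap fp fm / 4"
      "\<bar>freq W ?r (?c - {?r}) a - pmf fp a\<bar> < gap fp fm / 4"
      by (simp_all add: deviates_def not_le)
  qed
  \<comment> \<open>The supremum in \<open>profile_dist\<close> runs over all reals, but values
    outside \<open>A\<close> never occur.\<close>
  have off: "freq W x K a = 0" if "a \<notin> A" "x \<in> {1..n}" "K \<subseteq> {1..n} - {x}" for x K a
  proof -
    have "W x u \<in> A" if "u \<in> K" for u
    proof -
      have "u \<in> {1..n}" "x \<noteq> u" using that \<open>K \<subseteq> {1..n} - {x}\<close> by blast+
      then show ?thesis using side_info_support[OF W(1) \<open>x \<in> {1..n}\<close>] s by blast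
    qed
    then have "{u \<in> K. W x u = a} = {}" using \<open>a \<notin> A\<close> by auto
    then show ?thesis by (simp only: freq_def card.empty of_nat_0 div_0)
  qed
  show ?thesis
  proof (cases "v \<in> C")
    case True
    have "\<bar>freq W v ?c a - freq W ?r (?c - {?r}) a\<bar> \<le> gap fp fm / 2" for a
    proof (cases "a \<in> A")
      case aA: True
      have "\<bar>freq W v ?c a - pmf fp a\<bar> < gap fp fm / 4" using near(1)[OF aA] True by simp
      with near(2)[OF aA] show ?thesis by linarith
    next
      case False
      have "freq W v ?c a = 0" using sub v by (intro off[OF False]) auto
      moreover have "freq W ?r (?c - {?r}) a = 0" using sub r by (intro off[OF False]) blast+
      ultimately show ?thesis using gap by simp
    qed
    then show ?thesis using True profile_dist_le by blast
  next
    case False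
    have "?a \<in> A"
    proof (rule ccontr)
      assume "?a \<notin> A"
      then have "pmf fp ?a = 0" "pmf fm ?a = 0" using s(1,2) by (auto simp: set_pmf_iff)
      then show False using gap by (simp add: gap_def)
    qed
    from near[OF this] have "\<bar>freq W v ?c ?a - pmf fm ?a\<bar> < gap fp fm / 4"
      "\<bar>freq W ?r (?c - {?r}) ?a - pmf fp ?a\<bar> < gap fp fm / 4" using False by auto
    moreover have "\<bar>pmf fp ?a - pmf fm ?a\<bar> = gap fp fm" by (simp add: gap_def)
    ultimately have "\<bar>freq W v ?c ?a - freq W ?r (?c - {?r}) ?a\<bar> > gap fp fm / 2" by linarith
    then show ?thesis using False profile_dist_ge[of W v ?c ?a] by linarith
  qed
qed

text \<open>Take the scale with \<open>2 ^ j \<le> card c < 2 * 2 ^ j\<close> for the known part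
  \<open>c\<close> of the cluster of \<open>v\<close>. Then \<open>c\<close> competes, and all
  competitors have at least \<open>Suc m\<close> members, so the minimiser passes the distance test
  and must be \<open>c\<close>. This is why twice \<open>Suc m\<close> is required.\<close>

lemma lv_guess_hits:
  assumes W: "W \<in> set_pmf (side_info n P fp fm)" "W \<notin> lv_bad n P A fp fm m" and gap: "gap fp fm > 0"
    and C: "C \<in> P" "v \<in> C" and large: "2 * Suc m \<le> card (C \<inter> {1..<v})"
  shows "C \<inter> {1..<v} \<in> set (lv_guesses n W v (revealed P v))"
proof -
  let ?c = "C \<inter> {1..<v}"
  define j where "j = floor_log (card ?c)"
  let ?T = "{c \<in> revealed P v. 2 ^ j \<le> card c}"
  let ?b = "arg_min_on (profile_dist W v) ?T"
  have v: "v \<in> {1..n}" using C partition_subset[OF C(1)] by blast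
  have "card ?c > 0" using large by simp
  then have j: "2 ^ j \<le> card ?c" unfolding j_def by (rule floor_log_exp2_le)
  have "card ?c < 2 * 2 ^ j" unfolding j_def by (rule floor_log_exp2_gt)
  then have "2 * Suc m < 2 * 2 ^ j" using large by (rule le_less_trans[rotated])
  then have jm: "Suc m \<le> 2 ^ j" by simp
  have "?c \<noteq> {}" using large by auto
  then have c: "?c \<in> ?T" using C(1) j by (auto simp: revealed_def)
  have "finite ?T"
    using finite_if_partial_clusters[OF partial_clusters_revealed] by simp
  then have b: "?b \<in> ?T" "\<not> (\<exists>x\<in>?T. profile_dist W v x < profile_dist W v ?b)"
    using arg_min_if_finite[of ?T "profile_dist W v"] c by blast+
  obtain D where D: "D \<in> P" "?b = D \<inter> {1..<v}" using b(1) by (auto simp: revealed_def)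
  have pairs: "(v, C) \<in> cluster_pairs n P (Suc m)" "(v, D) \<in> cluster_pairs n P (Suc m)"
    using v C(1) large D b(1) jm by (auto simp: cluster_pairs_def)
  have "profile_dist W v ?b \<le> profile_dist W v ?c" using b(2) c by (meson not_less)
  also have "\<dots> \<le> gap fp fm / 2" using profile_dist_separates[OF W gap pairs(1)] C(2) by blast
  finally have "v \<in> D" using profile_dist_separates[OF W gap pairs(2)] D(2) by simp
  then have "?b = ?c" using partition_on_unique[OF part D(1) C(1)] C(2) D(2) by blast
  moreover have "j < Suc (floor_log n)"
  proof -
    have "card ?c \<le> card {1..n}" using partition_subset[OF C(1)] by (intro card_mono) auto
    then show ?thesis using floor_log_le_iff[of "card ?c" n] by (simp add: j_def)
  qed
  ultimately show ?thesis
    using c unfolding lv_guesses_def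
    by (auto simp del: upt_Suc intro!: image_eqI[where x = j])
qed

text \<open>Every vertex pays for its guesses; only the early vertices of each cluster pay for the
  exhaustive list as well.\<close>

lemma num_queries_lv_tree_good:
  assumes W: "W \<in> set_pmf (side_info n P fp fm)" "W \<notin> lv_bad n P A fp fm m" and gap: "gap fp fm > 0"
  shows "num_queries P (lv_tree n W) \<le> n * Suc (floor_log n) + card P * (2 * Suc m) * card P"
proof -
  define E where "E = (\<Union>C\<in>P. {v \<in> C. card (C \<inter> {1..<v}) < 2 * Suc m})"
  let ?L = "Suc (floor_log n)"
  have E: "{1..n} \<inter> E = E" using partition_subset by (auto simp: E_def)
  have "num_queries P (lv_tree n W) \<le>
     (\<Sum>v = 1..n. ask_cost P v (lv_guesses n W v (revealed P v) @ enum (revealed P v)))"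
    using run_lv_tree by blast
  also have "\<dots> \<le> (\<Sum>v = 1..n. ?L + (if v \<in> E then card P else 0))"
  proof (rule sum_mono)
    fix v assume "v \<in> {1..n}"
    then have "v \<in> \<Union>P" by (simp only: partition_onD1[OF part])
    then obtain C where C: "C \<in> P" "v \<in> C" by blast
    show "ask_cost P v (lv_guesses n W v (revealed P v) @ enum (revealed P v))
        \<le> ?L + (if v \<in> E then card P else 0)"
    proof (cases "v \<in> E")
      case True
      then show ?thesis using ask_cost_lv_le[of v W] by simp
    next
      case False
      then have large: "2 * Suc m \<le> card (C \<inter> {1..<v})" using C by (auto simp: E_def)
      then have "C \<inter> {1..<v} \<in> revealed P v" using C by (auto simp: revealed_def)
      then have "same_cluster P v (Min (C \<inter> {1..<v}))" using revealed_match[OF C] by simp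
      from ask_cost_append_le[OF lv_guess_hits[OF W gap C large] this]
      show ?thesis using length_lv_guesses[of n W v "revealed P v"] False
        by (meson le_trans trans_le_add1)
    qed
  qed
  also have "\<dots> = n * ?L + card E * card P"
    using E by (simp only: sum.distrib sum.If_cases finite_atLeastAtMost) (simp add: Int_def)
  also have "\<dots> \<le> n * ?L + card P * (2 * Suc m) * card P"
    using card_early_vertices[of "2 * Suc m"] unfolding E_def
    by (intro add_left_mono mult_right_mono) auto
  finally show ?thesis .
qed

lemma expected_queries_lv_tree:
  assumes kl: "sym_kl fp fm > 0" and "n \<ge> 1"
  shows "(\<integral>\<^sup>+ W. ennreal (real (num_queries P (lv_tree n W))) \<partial>measure_pmf (side_info n P fp fm))
    \<le> ennreal ((4 + 24 / \<epsilon> + 56 / \<epsilon>\<^sup>2) *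
        (real n * ln (real n) + (real (card P))\<^sup>2 * ln (real n) / sym_kl fp fm))"
proof (cases "n \<ge> 2")
  case False
  then have "n = 1" using assms by simp
  moreover have "enum {} = []" using enum[of "{}"] by simp
  ultimately show ?thesis by (simp add: lv_tree_def lv_guesses_def)
next
  case n: True
  let ?k = "real (card P)"
  let ?l = "ln (real n)"
  let ?z = "?l / (\<epsilon>\<^sup>2 * sym_kl fp fm)"
  let ?L = "Suc (floor_log n)"
  let ?p = "measure_pmf.prob (side_info n P fp fm)"
  note bounds = sym_kl_pos_bounds[OF kl n]
  have l: "?l \<ge> 1 / 2" by (rule half_le_ln[OF n])
  have g: "(gap fp fm)\<^sup>2 > 0" using bounds(2) by simp
  define m where "m = nat \<lceil>24 * ?l / (gap fp fm)\<^sup>2\<rceil>"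
  have pos: "24 * ?l / (gap fp fm)\<^sup>2 > 0" using l g by (intro divide_pos_pos) auto
  have m1: "m \<ge> 1" unfolding m_def using pos by linarith
  have "24 * ?l / (gap fp fm)\<^sup>2 \<le> real m" unfolding m_def by (rule real_nat_ceiling_ge)
  then have m2: "24 * ?l \<le> real m * (gap fp fm)\<^sup>2" using g by (simp add: pos_divide_le_eq)
  have "real m \<le> 24 * ?l / (gap fp fm)\<^sup>2 + 1" unfolding m_def using pos by linarith
  also have "24 * ?l / (gap fp fm)\<^sup>2 = 24 * ?l * (1 / (gap fp fm)\<^sup>2)" by simp
  also have "\<dots> \<le> 24 * ?l * (1 / (\<epsilon>\<^sup>2 * sym_kl fp fm))"
    using bounds(3) l by (intro mult_left_mono) auto
  \<comment> \<open>Rounding and the successor add 2, which is at most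
    \<open>4 * ?z\<close>.\<close>
  finally have m3: "real (Suc m) \<le> 28 * ?z" using bounds(4) by simp
  let ?B = "lv_bad n P A fp fm m"
  \<comment> \<open>\<open>X\<close> bounds the cost on the good event and \<open>Y\<close> the cost
    of any run.\<close>
  define X where "X = real (n * ?L + card P * (2 * Suc m) * card P)"
  define Y where "Y = real (n * (?L + card P))"
  have "(\<integral>\<^sup>+ W. ennreal (real (num_queries P (lv_tree n W))) \<partial>measure_pmf (side_info n P fp fm))
      \<le> (\<integral>\<^sup>+ W. ennreal X + ennreal Y * indicator ?B W \<partial>measure_pmf (side_info n P fp fm))"
  proof (rule nn_integral_mono_AE, rule AE_pmfI)
    fix W assume W: "W \<in> set_pmf (side_info n P fp fm)"
    show "ennreal (real (num_queries P (lv_tree n W))) \<le> ennreal X + ennreal Y * indicator ?B W"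
    proof (cases "W \<in> ?B")
      case True
      have "ennreal (real (num_queries P (lv_tree n W))) \<le> ennreal Y"
        unfolding Y_def using num_queries_lv_tree_le[of W]
        by (intro ennreal_leI) (simp only: of_nat_le_iff)
      also have "\<dots> \<le> ennreal X + ennreal Y" by simp
      finally show ?thesis using True by simp
    next
      case False
      have "ennreal (real (num_queries P (lv_tree n W))) \<le> ennreal X"
        unfolding X_def using num_queries_lv_tree_good[OF W False bounds(2)]
        by (intro ennreal_leI) (simp only: of_nat_le_iff)
      then show ?thesis using False by simp
    qed
  qed
  also have "\<dots> = ennreal X + ennreal Y * emeasure (measure_pmf (side_info n P fp fm)) ?B"
    by (subst nn_integral_add) (auto simp: nn_integral_cmult)
  also have "\<dots> = ennreal (X + Y * ?p ?B)"
    by (simp add: measure_pmf.emeasure_eq_measure X_def Y_def ennreal_mult ennreal_plus)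
  also have "\<dots> \<le> ennreal ((4 + 24 / \<epsilon> + 56 / \<epsilon>\<^sup>2) *
        (real n * ?l + ?k\<^sup>2 * ?l / sym_kl fp fm))"
  proof (rule ennreal_leI)
    have L: "real ?L \<le> 4 * ?l" by (rule Suc_floor_log_le[OF n])
    have "Y * ?p ?B \<le> Y * (4 / (\<epsilon> * real n))"
      using prob_lv_bad[OF m1 m2 assms(2)] by (intro mult_left_mono) (auto simp: Y_def)
    also have "\<dots> = 4 / \<epsilon> * (real ?L + ?k)" using n \<epsilon> by (simp add: Y_def field_simps)
    \<comment> \<open>Both \<open>?L\<close> and \<open>?k\<close> are absorbed by
      \<open>n * ln n\<close>, using \<open>card P \<le> n\<close>.\<close>
    also have "\<dots> \<le> 4 / \<epsilon> * (6 * (real n * ?l))"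
    proof (rule mult_left_mono)
      have "?l \<le> real n * ?l" using mult_right_mono[of 1 "real n" ?l] n l by simp
      moreover have "?k \<le> real n * (2 * ?l)"
      proof -
        have "?k \<le> real n * 1" using card_partition_le by simp
        also have "\<dots> \<le> real n * (2 * ?l)" using l by (intro mult_left_mono) auto
        finally show ?thesis .
      qed
      ultimately show "real ?L + ?k \<le> 6 * (real n * ?l)" using L by linarith
    qed (use \<epsilon> in auto)
    finally have YB: "Y * ?p ?B \<le> 24 / \<epsilon> * (real n * ?l)" by simp
    have "X = real n * real ?L + 2 * ?k\<^sup>2 * real (Suc m)"
      by (simp add: X_def power2_eq_square algebra_simps)
    also have "\<dots> \<le> real n * (4 * ?l) + 2 * ?k\<^sup>2 * (28 * ?z)"
      using L m3 by (intro add_mono mult_left_mono) auto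
    also have "2 * ?k\<^sup>2 * (28 * ?z) = 56 / \<epsilon>\<^sup>2 * (?k\<^sup>2 * ?l / sym_kl fp fm)" by simp
    finally have XB: "X \<le> 4 * (real n * ?l) + 56 / \<epsilon>\<^sup>2 * (?k\<^sup>2 * ?l / sym_kl fp fm)" by simp
    \<comment> \<open>Nonnegative cross terms allow a single constant for both summands.\<close>
    have "0 \<le> 56 / \<epsilon>\<^sup>2 * (real n * ?l)" "0 \<le> (4 + 24 / \<epsilon>) * (?k\<^sup>2 * ?l / sym_kl fp fm)"
      using \<epsilon> l kl by (auto intro!: mult_nonneg_nonneg divide_nonneg_nonneg)
    with XB YB show "X + Y * ?p ?B \<le> (4 + 24 / \<epsilon> + 56 / \<epsilon>\<^sup>2) *
        (real n * ?l + ?k\<^sup>2 * ?l / sym_kl fp fm)"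
      unfolding distrib_left distrib_right by linarith
  qed
  finally show ?thesis .
qed

end

end

theorem theorem4:
  "(\<exists>mc :: mc_alg.
      (\<forall>n fp fm W. \<forall>t\<in>set_pmf (mc n fp fm W). valid_qtree n t) \<and>
      (\<forall>\<epsilon>>0. \<exists>C>0. \<forall>A fp fm n k P.
         admissible \<epsilon> A fp fm \<and> n \<ge> 1 \<and> partition_on {1..n} P \<and> card P = k \<longrightarrow>
           measure_pmf.prob (bind_pmf (side_info n P fp fm) (mc n fp fm)) {t. run P t = P}
             \<ge> 1 - 1 / real n \<and>
           (sym_kl fp fm > 0 \<longrightarrow>
             (\<forall>W\<in>set_pmf (side_info n P fp fm). \<forall>t\<in>set_pmf (mc n fp fm W).
                real (num_queries P t) \<le> C * ((real k)\<^sup>2 * ln (real n) / sym_kl fp fm))))) \<and>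
   (\<exists>lv :: lv_alg.
      (\<forall>n W. \<forall>t\<in>set_pmf (lv n W). valid_qtree n t) \<and>
      (\<forall>\<epsilon>>0. \<exists>C>0. \<forall>A fp fm n k P.
         admissible \<epsilon> A fp fm \<and> n \<ge> 1 \<and> partition_on {1..n} P \<and> card P = k \<longrightarrow>
           (\<forall>W\<in>set_pmf (side_info n P fp fm). \<forall>t\<in>set_pmf (lv n W). run P t = P) \<and>
           (sym_kl fp fm > 0 \<longrightarrow>
             (\<integral>\<^sup>+ t. ennreal (real (num_queries P t))
                 \<partial>measure_pmf (bind_pmf (side_info n P fp fm) (lv n)))
               \<le> ennreal (C * (real n * ln (real n)
                      + (real k)\<^sup>2 * ln (real n) / sym_kl fp fm)))))"
proof (intro conjI)
  show "\<exists>mc :: mc_alg.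
      (\<forall>n fp fm W. \<forall>t\<in>set_pmf (mc n fp fm W). valid_qtree n t) \<and>
      (\<forall>\<epsilon>>0. \<exists>C>0. \<forall>A fp fm n k P.
         admissible \<epsilon> A fp fm \<and> n \<ge> 1 \<and> partition_on {1..n} P \<and> card P = k \<longrightarrow>
           measure_pmf.prob (bind_pmf (side_info n P fp fm) (mc n fp fm)) {t. run P t = P}
             \<ge> 1 - 1 / real n \<and>
           (sym_kl fp fm > 0 \<longrightarrow>
             (\<forall>W\<in>set_pmf (side_info n P fp fm). \<forall>t\<in>set_pmf (mc n fp fm W).
                real (num_queries P t) \<le> C * ((real k)\<^sup>2 * ln (real n) / sym_kl fp fm))))"
  \<comment> \<open>No internal randomness is used: given the matrix, the algorithm is a point
    mass.\<close>
  proof (intro exI[of _ "\<lambda>n fp fm W. return_pmf (mc_tree n fp fm W)"] conjI allI impI)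
    fix \<epsilon> :: real assume \<epsilon>: "\<epsilon> > 0"
    show "\<exists>C>0. \<forall>A fp fm n k P.
         admissible \<epsilon> A fp fm \<and> n \<ge> 1 \<and> partition_on {1..n} P \<and> card P = k \<longrightarrow>
           measure_pmf.prob (bind_pmf (side_info n P fp fm) (\<lambda>W. return_pmf (mc_tree n fp fm W)))
             {t. run P t = P} \<ge> 1 - 1 / real n \<and>
           (sym_kl fp fm > 0 \<longrightarrow>
             (\<forall>W\<in>set_pmf (side_info n P fp fm). \<forall>t\<in>set_pmf (return_pmf (mc_tree n fp fm W)).
                real (num_queries P t) \<le> C * ((real k)\<^sup>2 * ln (real n) / sym_kl fp fm)))"
    proof (intro exI[of _ "12 / \<epsilon>\<^sup>2"] conjI allI impI)
      show "12 / \<epsilon>\<^sup>2 > 0" using \<epsilon> by simp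
    qed (use prob_mc_tree_correct[OF _ _ \<epsilon>] num_queries_mc_tree_le[OF _ _ \<epsilon>] in
          \<open>auto simp flip: map_pmf_def simp: vimage_def\<close>)
  qed (simp add: valid_mc_tree)
  show "\<exists>lv :: lv_alg.
      (\<forall>n W. \<forall>t\<in>set_pmf (lv n W). valid_qtree n t) \<and>
      (\<forall>\<epsilon>>0. \<exists>C>0. \<forall>A fp fm n k P.
         admissible \<epsilon> A fp fm \<and> n \<ge> 1 \<and> partition_on {1..n} P \<and> card P = k \<longrightarrow>
           (\<forall>W\<in>set_pmf (side_info n P fp fm). \<forall>t\<in>set_pmf (lv n W). run P t = P) \<and>
           (sym_kl fp fm > 0 \<longrightarrow>
             (\<integral>\<^sup>+ t. ennreal (real (num_queries P t))
                 \<partial>measure_pmf (bind_pmf (side_info n P fp fm) (lv n)))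
               \<le> ennreal (C * (real n * ln (real n)
                      + (real k)\<^sup>2 * ln (real n) / sym_kl fp fm))))"
  proof (intro exI[of _ "\<lambda>n W. return_pmf (lv_tree n W)"] conjI allI impI)
    fix \<epsilon> :: real assume \<epsilon>: "\<epsilon> > 0"
    show "\<exists>C>0. \<forall>A fp fm n k P.
         admissible \<epsilon> A fp fm \<and> n \<ge> 1 \<and> partition_on {1..n} P \<and> card P = k \<longrightarrow>
           (\<forall>W\<in>set_pmf (side_info n P fp fm). \<forall>t\<in>set_pmf (return_pmf (lv_tree n W)). run P t = P) \<and>
           (sym_kl fp fm > 0 \<longrightarrow>
             (\<integral>\<^sup>+ t. ennreal (real (num_queries P t))
                 \<partial>measure_pmf (bind_pmf (side_info n P fp fm) (\<lambda>W. return_pmf (lv_tree n W))))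
               \<le> ennreal (C * (real n * ln (real n)
                      + (real k)\<^sup>2 * ln (real n) / sym_kl fp fm)))"
    proof (intro exI[of _ "4 + 24 / \<epsilon> + 56 / \<epsilon>\<^sup>2"] conjI allI impI)
      show "4 + 24 / \<epsilon> + 56 / \<epsilon>\<^sup>2 > 0" using \<epsilon> by (intro add_pos_pos) auto
    qed (use run_lv_tree expected_queries_lv_tree[OF _ _ \<epsilon>] in
          \<open>auto simp flip: map_pmf_def\<close>)
  qed (simp add: valid_lv_tree)
qed

end
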